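(* Let $G$ and $H$ be finite groups and let $\pi$ be a set of primes. Suppose that $G$ has a hypercentral Hall $\pi$-subgroup. Suppose further that for every positive integer $n$, the number of conjugacy classes of $\pi$-elements of $G$ of size $n$ equals the number of conjugacy classes of $\pi$-elements of $H$ of size $n$. Then $H$ has a hypercentral Hall $\pi$-subgroup.
   Context: A $\pi$-element of a group is an element whose order is divisible only by primes in $\pi$. The hypercentre $\mathbf{Z}_\infty(G)$ of $G$ is the last term of the upper central series $1\le \mathbf{Z}_1(G)\le \mathbf{Z}_2(G)\le\cdots$, where $\mathbf{Z}_1(G)=\mathbf{Z}(G)$ and $\mathbf{Z}_{i+1}(G)/\mathbf{Z}_i(G)=\mathbf{Z}(G/\mathbf{Z}_i(G))$. A subgroup is hypercentral in $G$ if it is contained in $\mathbf{Z}_\infty(G)$. The size of the conjugacy class of $g$ is $|G:C_G(g)|$. *)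

theory Defs
  imports "HOL-Algebra.Algebra"
begin

definition pi_element :: "('a, 'b) monoid_scheme \<Rightarrow> nat set \<Rightarrow> 'a \<Rightarrow> bool" where
  "pi_element G \<pi> x \<longleftrightarrow> x \<in> carrier G \<and>
     (\<forall>p. Factorial_Ring.prime p \<and> p dvd group.ord G x \<longrightarrow> p \<in> \<pi>)"

definition hall_pi_subgroup :: "'a set \<Rightarrow> ('a, 'b) monoid_scheme \<Rightarrow> nat set \<Rightarrow> bool" where
  "hall_pi_subgroup P G \<pi> \<longleftrightarrow> subgroup P G \<and>
     (\<forall>p. Factorial_Ring.prime p \<and> p dvd card P \<longrightarrow> p \<in> \<pi>) \<and>
     (\<forall>p. Factorial_Ring.prime p \<and> p dvd card (rcosets\<^bsub>G\<^esub> P) \<longrightarrow> p \<notin> \<pi>)"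

text \<open>Upper central series: Z_0 = 1, and Z_{i+1} consists of those x whose coset
  x Z_i is central in G / Z_i, i.e. (xy) Z_i = (yx) Z_i for all y.\<close>
fun upper_central :: "('a, 'b) monoid_scheme \<Rightarrow> nat \<Rightarrow> 'a set" where
  "upper_central G 0 = {\<one>\<^bsub>G\<^esub>}"
| "upper_central G (Suc i) = {x \<in> carrier G. \<forall>y \<in> carrier G.
     upper_central G i #>\<^bsub>G\<^esub> (x \<otimes>\<^bsub>G\<^esub> y) = upper_central G i #>\<^bsub>G\<^esub> (y \<otimes>\<^bsub>G\<^esub> x)}"

definition hypercentre :: "('a, 'b) monoid_scheme \<Rightarrow> 'a set" where
  "hypercentre G = (\<Union>i. upper_central G i)"

definition conj_class :: "('a, 'b) monoid_scheme \<Rightarrow> 'a \<Rightarrow> 'a set" where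
  "conj_class G x = {g \<otimes>\<^bsub>G\<^esub> x \<otimes>\<^bsub>G\<^esub> inv\<^bsub>G\<^esub> g | g. g \<in> carrier G}"

definition num_pi_classes_of_size :: "('a, 'b) monoid_scheme \<Rightarrow> nat set \<Rightarrow> nat \<Rightarrow> nat" where
  "num_pi_classes_of_size G \<pi> n =
     card {C. \<exists>x. pi_element G \<pi> x \<and> C = conj_class G x \<and> card C = n}"

end

theory Submission
  imports Defs "HOL-Number_Theory.Cong"
begin

text \<open>
  Write \<open>u\<close> and \<open>v\<close> for the \<open>p\<close>-part and \<open>p'\<close>-part of a \<open>\<pi>\<close>-element, \<open>p \<in> \<pi>\<close>; let \<open>S\<close> and \<open>Z\<close> be the
  sets of all \<open>\<pi>\<close>-elements and of the central ones, \<open>A\<close> the \<open>\<pi>\<close>-elements of \<open>p\<close>-power class size,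
  and \<open>B\<close> those of class size prime to \<open>p\<close>. Hypercentral elements commute with all elements of
  coprime order, so in \<open>G\<close> the set \<open>A\<close> is given by ``\<open>v\<close> is central'' and \<open>B\<close> by ``\<open>u\<close> is central''.
  Hence \<open>|A| |B| = |Z| |S|\<close>, and \<open>|B|\<close> and \<open>|Z|\<close> have the same \<open>p\<close>-part. Both facts carry over to \<open>H\<close>.

  In \<open>H\<close> the statement about \<open>p\<close>-parts forces the centre of a Sylow \<open>p\<close>-subgroup \<open>P\<close> to be central,
  so \<open>u\<close> is central on \<open>B\<close> and \<open>v\<close> is central on \<open>A\<close>. With \<open>U\<close> the set of \<open>p\<close>-elements of \<open>p\<close>-power class size
  and \<open>Y\<close> the set of \<open>p'\<close>-elements in \<open>B\<close> this gives \<open>|A| |B| \<le> |U| |Y| |Z|\<close>, while \<open>|S| \<ge> |Y| |P|\<close> because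
  every \<open>y \<in> Y\<close> centralises a Sylow \<open>p\<close>-subgroup. Thus \<open>|U| \<ge> |P|\<close>. But \<open>U\<close> lies in every Sylow
  \<open>p\<close>-subgroup, so \<open>P = U\<close> is normal, and it is hypercentral because its \<open>H\<close>-classes are \<open>P\<close>-classes.
\<close>

section \<open>Orbit counting and fixed points modulo a prime for group actions\<close>

section \<open>Actions and conjugation\<close>

text \<open>\<open>BijGroup E\<close> contains only extensional functions, hence the restriction to
  \<open>E\<close>. The inverse of \<open>\<psi> g\<close> on \<open>E\<close> is
  \<open>\<psi> (inv g)\<close>.\<close>

lemma (in group) group_actionI:
  assumes closed: "\<And>g x. g \<in> carrier G \<Longrightarrow> x \<in> E \<Longrightarrow> \<psi> g x \<in> E"
    and one: "\<And>x. x \<in> E \<Longrightarrow> \<psi> \<one> x = x"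
    and mult: "\<And>g h x. g \<in> carrier G \<Longrightarrow> h \<in> carrier G \<Longrightarrow> x \<in> E \<Longrightarrow> \<psi> (g \<otimes> h) x = \<psi> g (\<psi> h x)"
  shows "group_action G E (\<lambda>g. restrict (\<psi> g) E)"
proof -
  have inv: "\<psi> (inv g) (\<psi> g x) = x" "\<psi> g (\<psi> (inv g) x) = x" if "g \<in> carrier G" "x \<in> E" for g x
    using mult[of "inv g" g x] mult[of g "inv g" x] one that by auto
  have bij: "bij_betw (\<psi> g) E E" if g: "g \<in> carrier G" for g
    by (rule bij_betw_byWitness[where f' = "\<psi> (inv g)"]) (use g inv closed in auto)
  have "(\<lambda>g. restrict (\<psi> g) E) \<in> hom G (BijGroup E)"
  proof (rule homI)
    show "restrict (\<psi> g) E \<in> carrier (BijGroup E)" if "g \<in> carrier G" for g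
      using bij[OF that] by (simp add: BijGroup_def Bij_def)
    then show "restrict (\<psi> (g \<otimes> h)) E = restrict (\<psi> g) E \<otimes>\<^bsub>BijGroup E\<^esub> restrict (\<psi> h) E"
      if "g \<in> carrier G" "h \<in> carrier G" for g h
      using that mult closed by (auto simp: BijGroup_def compose_def fun_eq_iff)
  qed
  then show ?thesis
    unfolding group_action_def group_hom_def group_hom_axioms_def using group_BijGroup group_axioms by auto
qed

lemma (in group) orbit_stabilizer:
  assumes "finite (carrier G)" and x: "x \<in> E"
    and "\<And>g x. g \<in> carrier G \<Longrightarrow> x \<in> E \<Longrightarrow> \<psi> g x \<in> E"
    and "\<And>x. x \<in> E \<Longrightarrow> \<psi> \<one> x = x"
    and "\<And>g h x. g \<in> carrier G \<Longrightarrow> h \<in> carrier G \<Longrightarrow> x \<in> E \<Longrightarrow> \<psi> (g \<otimes> h) x = \<psi> g (\<psi> h x)"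
  shows "card {\<psi> g x |g. g \<in> carrier G} * card {g \<in> carrier G. \<psi> g x = x} = order G"
proof -
  interpret A: group_action G E "\<lambda>g. restrict (\<psi> g) E"
    by (rule group_actionI) (use assms in auto)
  show ?thesis
    using A.orbit_stabilizer_theorem[OF x] x by (simp add: orbit_def stabilizer_def)
qed

text \<open>Orbit sizes divide \<open>p ^ n\<close>, so every orbit of more than one point has size
  divisible by \<open>p\<close>; each fixed point is an orbit by itself.\<close>

lemma (in group) card_fixed_points_cong:
  assumes fin: "finite E" and p: "Factorial_Ring.prime (p::nat)" and ord: "order G = p ^ n"
    and closed: "\<And>g x. g \<in> carrier G \<Longrightarrow> x \<in> E \<Longrightarrow> \<psi> g x \<in> E"
    and one: "\<And>x. x \<in> E \<Longrightarrow> \<psi> \<one> x = x"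
    and mult: "\<And>g h x. g \<in> carrier G \<Longrightarrow> h \<in> carrier G \<Longrightarrow> x \<in> E \<Longrightarrow> \<psi> (g \<otimes> h) x = \<psi> g (\<psi> h x)"
  shows "[card E = card {x \<in> E. \<forall>g \<in> carrier G. \<psi> g x = x}] (mod p)"
proof -
  define F where "F = {x \<in> E. \<forall>g \<in> carrier G. \<psi> g x = x}"
  define orb where "orb = (\<lambda>x. {\<psi> g x |g. g \<in> carrier G})"
  have finG: "finite (carrier G)"
    using ord p order_gt_0_iff_finite by (simp add: prime_gt_0_nat)
  interpret A: group_action G E "\<lambda>g. restrict (\<psi> g) E"
    by (rule group_actionI) (use closed one mult in auto)
  have "orbit G (\<lambda>g. restrict (\<psi> g) E) x = orb x" if "x \<in> E" for x
    using that by (simp add: orbit_def orb_def)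
  then have orbs: "orbits G E (\<lambda>g. restrict (\<psi> g) E) = orb ` E"
    unfolding orbits_def by auto
  have self: "x \<in> orb x" if "x \<in> E" for x
    using one[OF that] unfolding orb_def by (metis (mono_tags, lifting) mem_Collect_eq one_closed)
  have p_dvd: "p dvd card (orb x)" if x: "x \<in> E - F" for x
  proof -
    have xE: "x \<in> E" using x by blast
    have "card (orb x) * card {g \<in> carrier G. \<psi> g x = x} = p ^ n"
      using orbit_stabilizer[of x E \<psi>, OF finG xE closed one mult] ord by (simp add: orb_def)
    then have "card (orb x) dvd p ^ n" by (metis dvd_triv_left)
    then obtain k where k: "card (orb x) = p ^ k"
      using p divides_primepow_nat by blast
    have "card (orb x) \<noteq> 1"
    proof
      assume "card (orb x) = 1"
      then obtain y where "orb x = {y}" by (auto simp: card_1_singleton_iff)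
      then have "orb x = {x}" using self[OF xE] by simp
      then have "\<forall>g \<in> carrier G. \<psi> g x = x" unfolding orb_def by blast
      then show False using x by (simp add: F_def)
    qed
    then show ?thesis using k by (cases k) auto
  qed
  have E: "F \<union> (E - F) = E" by (auto simp: F_def)
  have sing: "orb x = {x}" if "x \<in> F" for x
    using that self[of x] by (auto simp: F_def orb_def)
  have "card E = (\<Sum>R \<in> orb ` E. card R)"
    using A.disjoint_sum[OF fin, of "\<lambda>_. 1 :: nat"] orbs by simp
  also have "\<dots> = (\<Sum>R \<in> orb ` F. card R) + (\<Sum>R \<in> orb ` (E - F). card R)"
  proof -
    \<comment> \<open>Orbits of fixed points are singletons and all others have size divisible by
      \<open>p\<close>, so no orbit belongs to both families.\<close>
    have "orb ` F \<inter> orb ` (E - F) = {}"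
    proof (rule ccontr)
      assume "\<not> ?thesis"
      then obtain x y where xy: "x \<in> F" "y \<in> E - F" "orb x = orb y" by blast
      then have "orb y = {x}" using sing by simp
      then show False using p_dvd[OF xy(2)] p by simp
    qed
    moreover have "finite (orb ` F)" "finite (orb ` (E - F))"
      using fin by (simp_all add: F_def)
    ultimately show ?thesis
      using sum.union_disjoint[of "orb ` F" "orb ` (E - F)" card] E by (metis image_Un)
  qed
  also have "(\<Sum>R \<in> orb ` F. card R) = card F"
  proof -
    have "orb ` F = (\<lambda>x. {x}) ` F" using sing by (intro image_cong) auto
    then show ?thesis by (simp add: sum.reindex)
  qed
  finally have "card E = card F + (\<Sum>R \<in> orb ` (E - F). card R)" .
  moreover have "p dvd (\<Sum>R \<in> orb ` (E - F). card R)"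
    using p_dvd by (intro dvd_sum) blast
  ultimately have "[card E = card F] (mod p)"
    by (auto simp: cong_def elim!: dvdE)
  then show ?thesis by (simp add: F_def)
qed

section \<open>Centralizers, the centre, and elements of p-power and p'-order\<close>

definition centralizer :: "('a, 'b) monoid_scheme \<Rightarrow> 'a \<Rightarrow> 'a set" where
  "centralizer G x = {g \<in> carrier G. g \<otimes>\<^bsub>G\<^esub> x = x \<otimes>\<^bsub>G\<^esub> g}"

definition centre :: "('a, 'b) monoid_scheme \<Rightarrow> 'a set" where
  "centre G = {z \<in> carrier G. \<forall>g \<in> carrier G. g \<otimes>\<^bsub>G\<^esub> z = z \<otimes>\<^bsub>G\<^esub> g}"

definition p_element :: "('a, 'b) monoid_scheme \<Rightarrow> nat \<Rightarrow> 'a \<Rightarrow> bool" where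
  "p_element G p x \<longleftrightarrow> x \<in> carrier G \<and> (\<exists>k. group.ord G x = p ^ k)"

definition p'_element :: "('a, 'b) monoid_scheme \<Rightarrow> nat \<Rightarrow> 'a \<Rightarrow> bool" where
  "p'_element G p x \<longleftrightarrow> x \<in> carrier G \<and> coprime p (group.ord G x)"

text \<open>Splitting off the full power of \<open>p\<close> leaves a factor without prime
  divisors.\<close>

lemma prime_power_if_no_other_prime:
  assumes p: "Factorial_Ring.prime (p::nat)" and n: "n > 0"
    and q: "\<And>q. Factorial_Ring.prime q \<Longrightarrow> q dvd n \<Longrightarrow> q = p"
  shows "\<exists>k. n = p ^ k"
proof -
  obtain r where r: "n = p ^ multiplicity p n * r" "\<not> p dvd r"
    using multiplicity_decompose'[of n p] n p not_prime_unit by (metis neq0_conv)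
  have "r = 1"
  proof (rule ccontr)
    assume "r \<noteq> 1"
    then obtain s where s: "Factorial_Ring.prime s" "s dvd r" using prime_factor_nat by blast
    then have "s dvd n" using r(1) by (metis dvd_mult)
    then show False using q s r(2) by blast
  qed
  then show ?thesis using r(1) by auto
qed

locale finite_group = group +
  assumes finite_carrier [simp]: "finite (carrier G)"
begin

lemma order_pos [simp]: "order G > 0"
  by (simp add: order_gt_0_iff_finite)

lemma finite_subset_carrier: "A \<subseteq> carrier G \<Longrightarrow> finite A"
  using finite_subset finite_carrier by blast

lemma subgroup_finite_group: "subgroup K G \<Longrightarrow> finite_group (G\<lparr>carrier := K\<rparr>)"
  by (simp add: finite_group_def finite_group_axioms_def subgroup.subgroup_is_group[OF _ group_axioms]
      finite_subset_carrier subgroup.subset)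

lemma subgroup_card_dvd: "subgroup K G \<Longrightarrow> card K dvd order G"
  using lagrange by (metis dvd_triv_right)

lemma subgroup_card_pos: "subgroup K G \<Longrightarrow> card K > 0"
  using finite_subset_carrier subgroup.subset subgroup.one_closed by (metis card_gt_0_iff empty_iff)

lemma subgroup_subset_card_dvd:
  assumes "subgroup K G" "subgroup L G" "K \<subseteq> L"
  shows "card K dvd card L"
  using finite_group.subgroup_card_dvd[OF subgroup_finite_group[OF assms(2)]]
    subgroup_incl[OF assms] by (simp add: order_def)

lemma subgroup_nat_pow_closed: "subgroup K G \<Longrightarrow> x \<in> K \<Longrightarrow> x [^] (n::nat) \<in> K"
  by (induction n) (auto simp: subgroup.one_closed subgroup.m_closed)

lemma ord_subgroup: "subgroup K G \<Longrightarrow> x \<in> K \<Longrightarrow> group.ord (G\<lparr>carrier := K\<rparr>) x = ord x"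
proof -
  assume K: "subgroup K G" "x \<in> K"
  interpret K: finite_group "G\<lparr>carrier := K\<rparr>" by (rule subgroup_finite_group[OF K(1)])
  have "\<forall>n. (x [^]\<^bsub>G\<lparr>carrier := K\<rparr>\<^esub> n = \<one>\<^bsub>G\<lparr>carrier := K\<rparr>\<^esub>) = (ord x dvd n)"
    using K by (simp add: nat_pow_consistent[symmetric] pow_eq_id subgroup.mem_carrier)
  then show ?thesis using K(2) by (simp add: K.ord_unique)
qed

lemma ord_dvd_card_subgroup:
  assumes "subgroup K G" "x \<in> K"
  shows "ord x dvd card K"
proof -
  interpret K: finite_group "G\<lparr>carrier := K\<rparr>" by (rule subgroup_finite_group[OF assms(1)])
  show ?thesis
    using K.ord_dvd_group_order[of x] assms ord_subgroup by (simp add: order_def)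
qed

lemma generate_single: "x \<in> carrier G \<Longrightarrow> subgroup (generate G {x}) G" "x \<in> carrier G \<Longrightarrow> card (generate G {x}) = ord x"
  "x \<in> carrier G \<Longrightarrow> generate G {x} = {x [^] k |k. k \<in> (UNIV :: nat set)}"
  using generate_is_subgroup[of "{x}"] generate_pow_card generate_pow_on_finite_carrier[OF finite_carrier] by auto

lemma inv_cancel_left:
  "\<lbrakk>g \<in> carrier G; x \<in> carrier G\<rbrakk> \<Longrightarrow> inv g \<otimes> (g \<otimes> x) = x"
  "\<lbrakk>g \<in> carrier G; x \<in> carrier G\<rbrakk> \<Longrightarrow> g \<otimes> (inv g \<otimes> x) = x"
  by (simp_all add: m_assoc[symmetric])

lemma inv_commute:
  assumes "g \<in> carrier G" "x \<in> carrier G" "g \<otimes> x = x \<otimes> g"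
  shows "inv g \<otimes> x = x \<otimes> inv g"
proof -
  have "inv g \<otimes> (x \<otimes> g) \<otimes> inv g = inv g \<otimes> (g \<otimes> x) \<otimes> inv g" using assms by simp
  then show ?thesis using assms(1,2) by (simp add: m_assoc inv_cancel_left)
qed

lemma mult_commute_left:
  assumes "g \<in> carrier G" "h \<in> carrier G" "x \<in> carrier G" "g \<otimes> x = x \<otimes> g" "h \<otimes> x = x \<otimes> h"
  shows "g \<otimes> h \<otimes> x = x \<otimes> (g \<otimes> h)"
  using assms by (metis m_assoc)

subsection \<open>Conjugation\<close>

lemma conj_mult:
  "\<lbrakk>g \<in> carrier G; h \<in> carrier G; x \<in> carrier G\<rbrakk> \<Longrightarrow>
     (g \<otimes> h) \<otimes> x \<otimes> inv (g \<otimes> h) = g \<otimes> (h \<otimes> x \<otimes> inv h) \<otimes> inv g"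
  by (simp add: inv_mult_group m_assoc)

lemma conj_eq_iff:
  assumes "g \<in> carrier G" "x \<in> carrier G" "y \<in> carrier G"
  shows "g \<otimes> x \<otimes> inv g = y \<longleftrightarrow> g \<otimes> x = y \<otimes> g"
proof
  assume "g \<otimes> x \<otimes> inv g = y"
  then have "y \<otimes> g = g \<otimes> x \<otimes> inv g \<otimes> g" by simp
  then show "g \<otimes> x = y \<otimes> g" using assms by (simp add: m_assoc)
next
  assume "g \<otimes> x = y \<otimes> g"
  then show "g \<otimes> x \<otimes> inv g = y" using assms by (simp add: m_assoc)
qed

lemma conj_distrib:
  "\<lbrakk>g \<in> carrier G; x \<in> carrier G; y \<in> carrier G\<rbrakk> \<Longrightarrow>
     g \<otimes> (x \<otimes> y) \<otimes> inv g = (g \<otimes> x \<otimes> inv g) \<otimes> (g \<otimes> y \<otimes> inv g)"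
  by (simp add: m_assoc inv_cancel_left)

lemma conj_inv_cancel:
  "\<lbrakk>g \<in> carrier G; x \<in> carrier G\<rbrakk> \<Longrightarrow> inv g \<otimes> (g \<otimes> x \<otimes> inv g) \<otimes> inv (inv g) = x"
  "\<lbrakk>g \<in> carrier G; x \<in> carrier G\<rbrakk> \<Longrightarrow> g \<otimes> (inv g \<otimes> x \<otimes> inv (inv g)) \<otimes> inv g = x"
  using conj_mult[of "inv g" g x] conj_mult[of g "inv g" x] by auto

lemma conj_pow:
  assumes "g \<in> carrier G" "x \<in> carrier G"
  shows "(g \<otimes> x \<otimes> inv g) [^] (n::nat) = g \<otimes> x [^] n \<otimes> inv g"
  by (induction n) (use assms in \<open>auto simp: conj_distrib\<close>)

lemma ord_conj:
  assumes "g \<in> carrier G" "x \<in> carrier G"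
  shows "ord (g \<otimes> x \<otimes> inv g) = ord x"
proof (subst ord_unique)
  have "(g \<otimes> y \<otimes> inv g = \<one>) = (y = \<one>)" if "y \<in> carrier G" for y
    using conj_eq_iff[of g y \<one>] assms that by auto
  then show "\<forall>n. ((g \<otimes> x \<otimes> inv g) [^] n = \<one>) = (ord x dvd n)"
    using assms by (simp add: conj_pow pow_eq_id)
qed (use assms in auto)

lemma centralizer_subgroup: "x \<in> carrier G \<Longrightarrow> subgroup (centralizer G x) G"
  by (rule subgroupI) (auto simp: centralizer_def inv_commute mult_commute_left)

lemma centralizer_iff: "g \<in> carrier G \<Longrightarrow> x \<in> carrier G \<Longrightarrow> g \<in> centralizer G x \<longleftrightarrow> g \<otimes> x \<otimes> inv g = x"
  by (simp add: centralizer_def conj_eq_iff)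

text \<open>Commuting is symmetric: \<open>g\<close> centralises \<open>x\<close> iff
  \<open>x\<close> lies in the subgroup \<open>centralizer G g\<close>, and a subgroup is closed
  under powers.\<close>

lemma centralizer_pow: "x \<in> carrier G \<Longrightarrow> centralizer G x \<subseteq> centralizer G (x [^] (n::nat))"
proof
  fix g assume x: "x \<in> carrier G" and "g \<in> centralizer G x"
  then have g: "g \<in> carrier G" "x \<in> centralizer G g" by (auto simp: centralizer_def)
  then have "x [^] n \<in> centralizer G g"
    using subgroup_nat_pow_closed[OF centralizer_subgroup] by blast
  then show "g \<in> centralizer G (x [^] n)" using g by (auto simp: centralizer_def)
qed

lemma centreD:
  "z \<in> centre G \<Longrightarrow> z \<in> carrier G"
  "z \<in> centre G \<Longrightarrow> g \<in> carrier G \<Longrightarrow> g \<otimes> z = z \<otimes> g"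
  unfolding centre_def by blast+

lemma centreI:
  "z \<in> carrier G \<Longrightarrow> (\<And>g. g \<in> carrier G \<Longrightarrow> g \<otimes> z = z \<otimes> g) \<Longrightarrow> z \<in> centre G"
  unfolding centre_def by blast

lemma centre_subgroup: "subgroup (centre G) G"
proof (rule subgroupI)
  show "inv z \<in> centre G" if z: "z \<in> centre G" for z
    using inv_commute[OF centreD(1)[OF z]] centreD[OF z] by (intro centreI) auto
  show "y \<otimes> z \<in> centre G" if y: "y \<in> centre G" and z: "z \<in> centre G" for y z
  proof (rule centreI)
    fix g assume g: "g \<in> carrier G"
    show "g \<otimes> (y \<otimes> z) = y \<otimes> z \<otimes> g"
      using mult_commute_left[of y z g] g centreD(1)[OF y] centreD(1)[OF z] centreD(2)[OF y g] centreD(2)[OF z g]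
      by simp
  qed (use centreD(1)[OF y] centreD(1)[OF z] in simp)
  show "centre G \<noteq> {}" by (metis centreI empty_iff l_one one_closed r_one)
qed (auto dest: centreD)

lemma centre_iff_centralizer: "x \<in> centre G \<longleftrightarrow> x \<in> carrier G \<and> centralizer G x = carrier G"
  unfolding centre_def centralizer_def by blast

text \<open>Orbit-stabiliser for a subgroup \<open>K\<close> that conjugates elements of the whole
  group. Taking \<open>K\<close> to be a Sylow subgroup compares its orbits with full
  classes.\<close>

lemma card_conj_orbit:
  assumes K: "subgroup K G" and x: "x \<in> carrier G"
  shows "card {g \<otimes> x \<otimes> inv g |g. g \<in> K} * card (K \<inter> centralizer G x) = card K"
proof -
  interpret K: finite_group "G\<lparr>carrier := K\<rparr>" by (rule subgroup_finite_group[OF K])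
  have sub: "K \<subseteq> carrier G" using K subgroup.subset by blast
  have "card {g \<otimes> x \<otimes> inv g |g. g \<in> K} * card {g \<in> K. g \<otimes> x \<otimes> inv g = x} = card K"
    using K.orbit_stabilizer[OF K.finite_carrier x, of "\<lambda>g x. g \<otimes> x \<otimes> inv g"] sub x
    by (auto simp: order_def conj_mult subset_iff)
  moreover have "{g \<in> K. g \<otimes> x \<otimes> inv g = x} = K \<inter> centralizer G x"
    using sub x centralizer_iff by (auto simp: subset_iff)
  ultimately show ?thesis by simp
qed

lemma card_conj_class:
  assumes "x \<in> carrier G"
  shows "card (conj_class G x) * card (centralizer G x) = order G"
proof -
  have "carrier G \<inter> centralizer G x = centralizer G x" by (auto simp: centralizer_def)
  then show ?thesis
    using card_conj_orbit[OF subgroup_self assms] by (simp add: conj_class_def order_def)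
qed

lemma conj_class_self: "x \<in> carrier G \<Longrightarrow> x \<in> conj_class G x"
  unfolding conj_class_def by (auto intro!: exI[of _ \<one>])

lemma conj_class_subset: "x \<in> carrier G \<Longrightarrow> conj_class G x \<subseteq> carrier G"
  by (auto simp: conj_class_def)

lemma conj_class_pos: "x \<in> carrier G \<Longrightarrow> card (conj_class G x) > 0"
  using card_conj_class[of x] order_pos by (metis mult_0 neq0_conv)

lemma conj_class_eqI:
  assumes "x \<in> carrier G" "y \<in> conj_class G x"
  shows "conj_class G y = conj_class G x"
proof -
  have *: "conj_class G y \<subseteq> conj_class G x" if "x \<in> carrier G" "y \<in> conj_class G x" for x y
  proof
    fix z assume "z \<in> conj_class G y"
    then obtain g h where "g \<in> carrier G" "h \<in> carrier G" "z = h \<otimes> (g \<otimes> x \<otimes> inv g) \<otimes> inv h"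
      using \<open>y \<in> conj_class G x\<close> by (auto simp: conj_class_def)
    then have "h \<otimes> g \<in> carrier G" "z = (h \<otimes> g) \<otimes> x \<otimes> inv (h \<otimes> g)"
      using \<open>x \<in> carrier G\<close> by (simp_all add: conj_mult)
    then show "z \<in> conj_class G x" unfolding conj_class_def by blast
  qed
  obtain g where g: "g \<in> carrier G" "y = g \<otimes> x \<otimes> inv g"
    using assms by (auto simp: conj_class_def)
  then have "x = inv g \<otimes> y \<otimes> inv (inv g)" using assms conj_inv_cancel by simp
  then have "x \<in> conj_class G y" using g unfolding conj_class_def by blast
  then show ?thesis using * assms conj_class_subset by blast
qed

text \<open>Class sizes are indices of centralizers, and the index of the larger subgroup divides
  that of the smaller one.\<close>

lemma conj_class_card_dvd:
  assumes "x \<in> carrier G" "y \<in> carrier G" "centralizer G x \<subseteq> centralizer G y"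
  shows "card (conj_class G y) dvd card (conj_class G x)"
proof -
  let ?c = "card (centralizer G x)"
  obtain k where k: "card (centralizer G y) = ?c * k"
    using subgroup_subset_card_dvd centralizer_subgroup assms by (metis dvdE)
  have "card (conj_class G x) * ?c = card (conj_class G y) * (?c * k)"
    unfolding k[symmetric] by (simp only: card_conj_class assms)
  also have "\<dots> = card (conj_class G y) * k * ?c" by simp
  finally have "card (conj_class G x) = card (conj_class G y) * k"
    using subgroup_card_pos[OF centralizer_subgroup[OF assms(1)]] by (simp only: mult_cancel2) simp
  then show ?thesis by simp
qed

lemma conj_class_card_eq_1_iff:
  assumes x: "x \<in> carrier G"
  shows "card (conj_class G x) = 1 \<longleftrightarrow> x \<in> centre G"
proof
  assume "card (conj_class G x) = 1"
  then have "card (centralizer G x) = card (carrier G)"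
    using card_conj_class[OF x] by (simp add: order_def)
  then have "centralizer G x = carrier G"
    using card_subset_eq[OF finite_carrier subgroup.subset[OF centralizer_subgroup[OF x]]] by blast
  then show "x \<in> centre G" using x centre_iff_centralizer by blast
next
  assume "x \<in> centre G"
  then have "centralizer G x = carrier G" using centre_iff_centralizer by blast
  then have "card (conj_class G x) * order G = 1 * order G"
    using card_conj_class[OF x] by (simp add: order_def)
  then show "card (conj_class G x) = 1" using order_pos by (simp only: mult_cancel2) simp
qed

subsection \<open>Sylow subgroups and primary parts\<close>

lemma p_element_carrier: "p_element G p x \<Longrightarrow> x \<in> carrier G"
  by (simp add: p_element_def)

lemma p'_element_carrier: "p'_element G p x \<Longrightarrow> x \<in> carrier G"
  by (simp add: p'_element_def)

lemma sylow_in: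
  assumes "subgroup K G" "Factorial_Ring.prime p"
  shows "\<exists>P. subgroup P G \<and> P \<subseteq> K \<and> card P = p ^ multiplicity p (card K)"
proof -
  interpret K: finite_group "G\<lparr>carrier := K\<rparr>" by (rule subgroup_finite_group[OF assms(1)])
  obtain m where m: "card K = p ^ multiplicity p (card K) * m"
    using multiplicity_dvd by (metis dvdE)
  then obtain P where "subgroup P (G\<lparr>carrier := K\<rparr>)" "card P = p ^ multiplicity p (card K)"
    using sylow_thm[OF assms(2) K.is_group, of "multiplicity p (card K)" m] K.finite_carrier m
    unfolding order_def by auto
  then show ?thesis
    using incl_subgroup[OF assms(1)] subgroup.subset by fastforce
qed

lemma p_elementI_subgroup:
  assumes "subgroup P G" "card P = p ^ n" "Factorial_Ring.prime p" "x \<in> P"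
  shows "p_element G p x"
  using ord_dvd_card_subgroup[OF assms(1,4)] assms(2) divides_primepow_nat[OF assms(3), of "ord x" n]
    subgroup.mem_carrier[OF assms(1,4)]
  by (auto simp: p_element_def)

text \<open>The cyclic \<open>p\<close>-group generated by \<open>x\<close> acts on the right cosets
  of \<open>C\<close>. Their number is prime to \<open>p\<close>, so some coset \<open>C g\<close>
  is fixed, and \<open>C g x = C g\<close> puts the conjugate of \<open>x\<close> by
  \<open>g\<close> into \<open>C\<close>.\<close>

lemma p_element_conj_in:
  assumes p: "Factorial_Ring.prime p" and C: "subgroup C G" and ndvd: "\<not> p dvd card (rcosets C)"
    and x: "p_element G p x"
  shows "\<exists>g \<in> carrier G. g \<otimes> x \<otimes> inv g \<in> C"
proof -
  have xc: "x \<in> carrier G" using x p_element_carrier by blast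
  obtain n where n: "ord x = p ^ n" using x by (auto simp: p_element_def)
  let ?X = "generate G {x}"
  have sub: "?X \<subseteq> carrier G" using generate_single(1)[OF xc] subgroup.subset by blast
  interpret X: finite_group "G\<lparr>carrier := ?X\<rparr>"
    by (rule subgroup_finite_group[OF generate_single(1)[OF xc]])
  have Cs: "C \<subseteq> carrier G" using C subgroup.subset by blast
  have coset: "R \<subseteq> carrier G" if "R \<in> rcosets C" for R
    using that rcosets_subset_PowG[OF C] by blast
  have "[card (rcosets C) = card {R \<in> rcosets C. \<forall>g \<in> carrier (G\<lparr>carrier := ?X\<rparr>). R #> inv g = R}] (mod p)"
  proof (rule X.card_fixed_points_cong[OF _ p])
    show "finite (rcosets C)" by (simp add: RCOSETS_def)
    show "order (G\<lparr>carrier := ?X\<rparr>) = p ^ n" using generate_single(2)[OF xc] n by (simp add: order_def)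
    \<comment> \<open>Right multiplication becomes a left action only after inverting
      \<open>g\<close>.\<close>
    show "R #> inv g \<in> rcosets C" if gR: "g \<in> carrier (G\<lparr>carrier := ?X\<rparr>)" "R \<in> rcosets C" for g R
    proof -
      obtain y where y: "y \<in> carrier G" "R = C #> y" using gR by (auto simp: RCOSETS_def)
      have g: "g \<in> carrier G" using gR sub by auto
      then have "R #> inv g = C #> (y \<otimes> inv g)" using y Cs by (simp add: coset_mult_assoc)
      then show ?thesis using rcosetsI[OF Cs, of "y \<otimes> inv g"] y g by simp
    qed
    show "R #> inv \<one>\<^bsub>G\<lparr>carrier := ?X\<rparr>\<^esub> = R" if "R \<in> rcosets C" for R
      using coset[OF that] by simp
    show "R #> inv (g \<otimes>\<^bsub>G\<lparr>carrier := ?X\<rparr>\<^esub> h) = R #> inv h #> inv g"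
      if "g \<in> carrier (G\<lparr>carrier := ?X\<rparr>)" "h \<in> carrier (G\<lparr>carrier := ?X\<rparr>)" "R \<in> rcosets C" for g h R
    proof -
      have "g \<in> carrier G" "h \<in> carrier G" using that sub by auto
      then show ?thesis using coset[OF that(3)] by (simp add: inv_mult_group coset_mult_assoc)
    qed
  qed
  then have "card {R \<in> rcosets C. \<forall>g \<in> carrier (G\<lparr>carrier := ?X\<rparr>). R #> inv g = R} \<noteq> 0"
    using ndvd by (metis cong_0_iff)
  then have "{R \<in> rcosets C. \<forall>g \<in> ?X. R #> inv g = R} \<noteq> {}"
    by (auto simp: card_eq_0_iff)
  then obtain g where g: "g \<in> carrier G" "\<forall>h \<in> ?X. C #> g #> inv h = C #> g"
    by (auto simp: RCOSETS_def)
  \<comment> \<open>The fixed-point condition at \<open>inv x\<close> undoes the inversion in the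
    action and gives invariance under right multiplication by \<open>x\<close> itself.\<close>
  have "inv x \<in> ?X" "x \<in> ?X"
    using generate.incl[of x "{x}" G] generate_single(1)[OF xc] subgroup.m_inv_closed by auto
  then have "C #> g #> x = C #> g" using g(2) xc by force
  then have "g \<otimes> x \<in> C #> g"
    using g(1) xc rcos_self[of "g \<otimes> x", OF _ C] Cs by (simp add: coset_mult_assoc)
  then have "g \<otimes> x \<otimes> inv g \<in> C"
    using subgroup.rcos_module_imp[OF C group_axioms g(1)] by blast
  then show ?thesis using g by blast
qed


section \<open>Factorisation of an element into commuting primary parts\<close>

lemma pow_cong:
  assumes "x \<in> carrier G" "[i = j] (mod ord x)"
  shows "x [^] (i::nat) = x [^] (j::nat)"
proof -
  have "int (ord x) dvd int j - int i"
    using assms(2) by (metis cong_iff_dvd_diff cong_int_iff cong_sym)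
  then have "x [^] int i = x [^] int j" using assms(1) int_pow_eq by blast
  then show ?thesis by (simp add: int_pow_int)
qed

definition sylow_card :: "nat \<Rightarrow> nat" where
  "sylow_card p = p ^ multiplicity p (order G)"

text \<open>The exponent comes from the Chinese remainder theorem and depends on the group order
  only, so one exponent serves all elements. Since the parts are then powers of \<open>x\<close>,
  they lie in every subgroup containing \<open>x\<close> and are centralised by whatever centralises
  \<open>x\<close>.\<close>

definition p_exponent :: "nat \<Rightarrow> nat" where
  "p_exponent p = (SOME e. [e = 1] (mod sylow_card p) \<and> [e = 0] (mod order G div sylow_card p))"

definition p'_exponent :: "nat \<Rightarrow> nat" where
  "p'_exponent p = (SOME e. [e = 0] (mod sylow_card p) \<and> [e = 1] (mod order G div sylow_card p))"

definition p_part :: "nat \<Rightarrow> 'a \<Rightarrow> 'a" where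
  "p_part p x = x [^] p_exponent p"

definition p'_part :: "nat \<Rightarrow> 'a \<Rightarrow> 'a" where
  "p'_part p x = x [^] p'_exponent p"

context
  fixes p :: nat
  assumes p: "Factorial_Ring.prime p"
begin

lemma order_sylow_card: "sylow_card p * (order G div sylow_card p) = order G"
  by (simp add: sylow_card_def multiplicity_dvd)

lemma coprime_p_index: "coprime p (order G div sylow_card p)"
proof -
  have "\<not> p dvd order G div sylow_card p"
    unfolding sylow_card_def using p order_pos
    by (metis multiplicity_decompose neq0_conv not_prime_unit)
  then show ?thesis using p prime_imp_coprime by blast
qed

lemma coprime_sylow_card_index: "coprime (sylow_card p) (order G div sylow_card p)"
  using coprime_p_index by (simp add: sylow_card_def)

lemma p_exponent:
  "[p_exponent p = 1] (mod sylow_card p)" "[p_exponent p = 0] (mod order G div sylow_card p)"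
  using someI_ex[OF binary_chinese_remainder_nat[OF coprime_sylow_card_index, of 1 0]]
  unfolding p_exponent_def by auto

lemma p'_exponent:
  "[p'_exponent p = 0] (mod sylow_card p)" "[p'_exponent p = 1] (mod order G div sylow_card p)"
  using someI_ex[OF binary_chinese_remainder_nat[OF coprime_sylow_card_index, of 0 1]]
  unfolding p'_exponent_def by auto

lemma exponents_sum: "[p_exponent p + p'_exponent p = 1] (mod order G)"
proof -
  have "[p_exponent p + p'_exponent p = 1 + 0] (mod sylow_card p)"
    by (intro cong_add p_exponent p'_exponent)
  moreover have "[p_exponent p + p'_exponent p = 0 + 1] (mod order G div sylow_card p)"
    by (intro cong_add p_exponent p'_exponent)
  ultimately show ?thesis
    using coprime_cong_mult_nat[OF _ _ coprime_sylow_card_index] order_sylow_card by simp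
qed

text \<open>Element orders divide the group order, so a \<open>p\<close>-power order divides the
  \<open>p\<close>-part of it. In this form being a \<open>p\<close>-element is a single equation,
  \<open>x [^] sylow_card p = \<one>\<close>.\<close>

lemma p_element_iff: "p_element G p x \<longleftrightarrow> x \<in> carrier G \<and> ord x dvd sylow_card p"
proof
  assume x: "p_element G p x"
  then have xc: "x \<in> carrier G" by (rule p_element_carrier)
  obtain k where k: "ord x = p ^ k" using x by (auto simp: p_element_def)
  then have "p ^ k dvd sylow_card p * (order G div sylow_card p)"
    using ord_dvd_group_order[OF xc] order_sylow_card by simp
  moreover have "coprime (p ^ k) (order G div sylow_card p)" using coprime_p_index by simp
  ultimately show "x \<in> carrier G \<and> ord x dvd sylow_card p"
    using coprime_dvd_mult_left_iff k xc by metis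
next
  assume "x \<in> carrier G \<and> ord x dvd sylow_card p"
  then show "p_element G p x"
    using divides_primepow_nat[OF p, of "ord x"] by (auto simp: p_element_def sylow_card_def)
qed

lemma p'_element_iff: "p'_element G p x \<longleftrightarrow> x \<in> carrier G \<and> ord x dvd order G div sylow_card p"
proof
  assume x: "p'_element G p x"
  then have "coprime (ord x) (sylow_card p)"
    by (simp add: p'_element_def sylow_card_def coprime_commute)
  moreover have "ord x dvd sylow_card p * (order G div sylow_card p)"
    using ord_dvd_group_order p'_element_carrier[OF x] order_sylow_card by simp
  ultimately show "x \<in> carrier G \<and> ord x dvd order G div sylow_card p"
    using coprime_dvd_mult_right_iff p'_element_carrier[OF x] by blast
next
  assume "x \<in> carrier G \<and> ord x dvd order G div sylow_card p"
  then show "p'_element G p x"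
    using coprime_p_index unfolding p'_element_def by (meson coprime_divisors dvd_refl)
qed

lemma parts_closed [simp]:
  "x \<in> carrier G \<Longrightarrow> p_part p x \<in> carrier G" "x \<in> carrier G \<Longrightarrow> p'_part p x \<in> carrier G"
  by (simp_all add: p_part_def p'_part_def)

lemma parts_mult: "x \<in> carrier G \<Longrightarrow> p_part p x \<otimes> p'_part p x = x"
proof -
  assume x: "x \<in> carrier G"
  have "[p_exponent p + p'_exponent p = 1] (mod ord x)"
    using exponents_sum ord_dvd_group_order[OF x] cong_dvd_modulus_nat by blast
  then have "x [^] (p_exponent p + p'_exponent p) = x [^] (1::nat)" by (rule pow_cong[OF x])
  then show ?thesis using x by (simp add: p_part_def p'_part_def nat_pow_mult)
qed

lemma parts_commute: "x \<in> carrier G \<Longrightarrow> p_part p x \<otimes> p'_part p x = p'_part p x \<otimes> p_part p x"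
  by (simp add: p_part_def p'_part_def nat_pow_comm)

lemma p_element_p_part: "x \<in> carrier G \<Longrightarrow> p_element G p (p_part p x)"
proof -
  assume x: "x \<in> carrier G"
  have "sylow_card p * (order G div sylow_card p) dvd sylow_card p * p_exponent p"
    using p_exponent(2) by (intro mult_dvd_mono) (simp_all add: cong_0_iff)
  then have "ord x dvd p_exponent p * sylow_card p"
    using ord_dvd_group_order[OF x] order_sylow_card by (metis dvd_trans mult.commute)
  then show ?thesis
    using x by (simp add: p_element_iff p_part_def pow_eq_id[symmetric] nat_pow_pow)
qed

lemma p'_element_p'_part: "x \<in> carrier G \<Longrightarrow> p'_element G p (p'_part p x)"
proof -
  assume x: "x \<in> carrier G"
  have "sylow_card p * (order G div sylow_card p) dvd p'_exponent p * (order G div sylow_card p)"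
    using p'_exponent(1) by (intro mult_dvd_mono) (simp_all add: cong_0_iff)
  then have "ord x dvd p'_exponent p * (order G div sylow_card p)"
    using ord_dvd_group_order[OF x] order_sylow_card by (metis dvd_trans)
  then show ?thesis
    using x by (simp add: p'_element_iff p'_part_def pow_eq_id[symmetric] nat_pow_pow)
qed

lemma parts_p_element:
  assumes "p_element G p x"
  shows "p_part p x = x" "p'_part p x = \<one>"
proof -
  have x: "x \<in> carrier G" "ord x dvd sylow_card p" using assms p_element_iff by auto
  have "x [^] p_exponent p = x [^] (1::nat)" "x [^] p'_exponent p = x [^] (0::nat)"
    using x p_exponent(1) p'_exponent(1) cong_dvd_modulus_nat by (blast intro: pow_cong)+
  then show "p_part p x = x" "p'_part p x = \<one>" using x by (simp_all add: p_part_def p'_part_def)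
qed

lemma parts_p'_element:
  assumes "p'_element G p x"
  shows "p_part p x = \<one>" "p'_part p x = x"
proof -
  have x: "x \<in> carrier G" "ord x dvd order G div sylow_card p" using assms p'_element_iff by auto
  have "x [^] p_exponent p = x [^] (0::nat)" "x [^] p'_exponent p = x [^] (1::nat)"
    using x p_exponent(2) p'_exponent(2) cong_dvd_modulus_nat by (blast intro: pow_cong)+
  then show "p_part p x = \<one>" "p'_part p x = x" using x by (simp_all add: p_part_def p'_part_def)
qed

text \<open>Uniqueness of the factorisation: powers distribute over the commuting product, and the
  two exponents act as 1 and 0 on \<open>a\<close>, and as 0 and 1 on \<open>b\<close>.\<close>

lemma parts_of_mult:
  assumes "p_element G p a" "p'_element G p b" "a \<otimes> b = b \<otimes> a"
  shows "p_part p (a \<otimes> b) = a" "p'_part p (a \<otimes> b) = b"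
proof -
  have ab: "a \<in> carrier G" "b \<in> carrier G"
    using assms p_element_carrier p'_element_carrier by auto
  have "(a \<otimes> b) [^] n = a [^] n \<otimes> b [^] n" for n :: nat
    using pow_mult_distrib[OF assms(3) ab] .
  then show "p_part p (a \<otimes> b) = a" "p'_part p (a \<otimes> b) = b"
    using parts_p_element[OF assms(1)] parts_p'_element[OF assms(2)] ab
    by (simp_all add: p_part_def p'_part_def)
qed

lemma centralizer_parts:
  "x \<in> carrier G \<Longrightarrow> centralizer G x \<subseteq> centralizer G (p_part p x)"
  "x \<in> carrier G \<Longrightarrow> centralizer G x \<subseteq> centralizer G (p'_part p x)"
  by (simp_all add: p_part_def p'_part_def centralizer_pow)

lemma subgroup_parts:
  "subgroup K G \<Longrightarrow> x \<in> K \<Longrightarrow> p_part p x \<in> K"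
  "subgroup K G \<Longrightarrow> x \<in> K \<Longrightarrow> p'_part p x \<in> K"
  by (simp_all add: p_part_def p'_part_def subgroup_nat_pow_closed)

text \<open>\<open>P\<close> is contained in \<open>M\<close>, the centralizer of \<open>x\<close>,
  with index prime to \<open>p\<close>. Hence some \<open>M\<close>-conjugate of the
  \<open>p\<close>-element \<open>x\<close> lies in \<open>P\<close>; but conjugation by
  \<open>M\<close> fixes \<open>x\<close>.\<close>

lemma p_element_in_sylow:
  assumes P: "subgroup P G" "card P = sylow_card p" and x: "p_element G p x"
    and PC: "P \<subseteq> centralizer G x"
  shows "x \<in> P"
proof -
  have xc: "x \<in> carrier G" using x p_element_carrier by blast
  define M where "M = centralizer G x"
  have M: "subgroup M G" using centralizer_subgroup[OF xc] by (simp add: M_def)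
  have xM: "x \<in> M" using xc by (simp add: M_def centralizer_def)
  interpret M: finite_group "G\<lparr>carrier := M\<rparr>" by (rule subgroup_finite_group[OF M])
  have PM: "subgroup P (G\<lparr>carrier := M\<rparr>)"
    using subgroup_incl[OF P(1) M] PC by (simp add: M_def)
  have "\<not> p dvd card (rcosets\<^bsub>G\<lparr>carrier := M\<rparr>\<^esub> P)"
  proof
    assume "p dvd card (rcosets\<^bsub>G\<lparr>carrier := M\<rparr>\<^esub> P)"
    then have "p * card P dvd card (rcosets\<^bsub>G\<lparr>carrier := M\<rparr>\<^esub> P) * card P"
      by (rule mult_dvd_mono) (rule dvd_refl)
    also have "card (rcosets\<^bsub>G\<lparr>carrier := M\<rparr>\<^esub> P) * card P = card M"
      using M.lagrange[OF PM] unfolding order_def by simp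
    also have "card M dvd sylow_card p * (order G div sylow_card p)"
      unfolding order_sylow_card by (rule subgroup_card_dvd[OF M])
    finally have "sylow_card p * p dvd sylow_card p * (order G div sylow_card p)"
      using P(2) by (simp only: mult.commute)
    moreover have "sylow_card p \<noteq> 0" using p by (simp add: sylow_card_def)
    ultimately have "p dvd order G div sylow_card p"
      using dvd_times_left_cancel_iff[of "sylow_card p"] by metis
    then show False using coprime_p_index p coprime_absorb_left not_prime_unit by blast
  qed
  moreover have "p_element (G\<lparr>carrier := M\<rparr>) p x"
    using x xM ord_subgroup[OF M xM] by (simp add: p_element_def)
  ultimately obtain g where g: "g \<in> M" "g \<otimes> x \<otimes> inv\<^bsub>G\<lparr>carrier := M\<rparr>\<^esub> g \<in> P"
    using M.p_element_conj_in[OF p PM] by auto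
  then have "g \<otimes> x \<otimes> inv g \<in> P" using m_inv_consistent[OF M] by simp
  moreover have "g \<otimes> x \<otimes> inv g = x"
    using g(1) xc centralizer_iff subgroup.mem_carrier[OF M] unfolding M_def by blast
  ultimately show ?thesis by simp
qed

end

text \<open>With \<open>d\<close> the least positive exponent such that
  \<open>x [^] d \<in> N\<close>, all exponents \<open>k\<close> with \<open>x [^] k \<in> N\<close>
  are multiples of \<open>d\<close>. A prime \<open>q\<close> dividing \<open>d\<close> would divide
  the order of \<open>G\<close> and also \<open>p_exponent q\<close>, which is 1 modulo
  \<open>q\<close>. So \<open>d = 1\<close>.\<close>

lemma mem_subgroup_if_parts_mem:
  assumes N: "subgroup N G" and x: "x \<in> carrier G"
    and parts: "\<And>q. Factorial_Ring.prime q \<Longrightarrow> q dvd order G \<Longrightarrow> p_part q x \<in> N"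
  shows "x \<in> N"
proof -
  define d :: nat where "d = (LEAST d. d > 0 \<and> x [^] d \<in> N)"
  have "order G > 0 \<and> x [^] order G \<in> N"
    using pow_order_eq_1[OF x] subgroup.one_closed[OF N] by simp
  then have "d > 0 \<and> x [^] d \<in> N"
    unfolding d_def by (rule LeastI)
  then have d: "d > 0" "x [^] d \<in> N" by auto
  have dvd: "d dvd k" if k: "x [^] k \<in> N" for k
  proof (rule ccontr)
    assume "\<not> d dvd k"
    then have pos: "k mod d > 0" by (simp add: dvd_eq_mod_eq_0)
    have "x [^] k = x [^] (d * (k div d)) \<otimes> x [^] (k mod d)"
      using x by (simp add: nat_pow_mult)
    then have "x [^] (k mod d) = inv ((x [^] d) [^] (k div d)) \<otimes> x [^] k"
      using x by (simp add: nat_pow_pow inv_cancel_left)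
    also have "\<dots> \<in> N"
      using N d(2) k by (simp add: subgroup.m_closed subgroup.m_inv_closed subgroup_nat_pow_closed)
    finally have "d \<le> k mod d" unfolding d_def using pos by (intro Least_le) (simp add: d_def)
    then show False using d(1) by (meson mod_less_divisor not_le)
  qed
  have "d = 1"
  proof (rule ccontr)
    assume "d \<noteq> 1"
    then obtain q where q: "Factorial_Ring.prime q" "q dvd d" using prime_factor_nat by blast
    have "d dvd order G" using \<open>order G > 0 \<and> x [^] order G \<in> N\<close> dvd by blast
    then have q_ord: "q dvd order G" using q(2) dvd_trans by blast
    then have "d dvd p_exponent q" using parts[OF q(1)] dvd by (simp add: p_part_def)
    then have "q dvd p_exponent q" using q(2) dvd_trans by blast
    moreover have "q dvd sylow_card q"
      unfolding sylow_card_def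
      using q_ord q(1) order_pos prime_multiplicity_gt_zero_iff[of q "order G"] by (simp add: dvd_power)
    then have "[p_exponent q = 1] (mod q)"
      using p_exponent(1)[OF q(1)] cong_dvd_modulus_nat by blast
    ultimately have "1 mod q = 0" by (simp add: cong_def)
    then show False using prime_gt_1_nat[OF q(1)] by simp
  qed
  then show ?thesis using d(2) x by simp
qed

lemma p'_element_if_p_element:
  assumes "Factorial_Ring.prime p" "Factorial_Ring.prime q" "p \<noteq> q" "p_element G q x"
  shows "p'_element G p x"
proof -
  obtain k where "ord x = q ^ k" using assms(4) by (auto simp: p_element_def)
  moreover have "coprime p (q ^ k)" using primes_coprime[OF assms(1-3)] by simp
  ultimately show ?thesis using p_element_carrier[OF assms(4)] by (simp add: p'_element_def)
qed

section \<open>Elements whose order involves only primes in \<open>\<pi>\<close>\<close>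

lemma pi_element_carrier: "pi_element G \<pi> x \<Longrightarrow> x \<in> carrier G"
  by (simp add: pi_element_def)

lemma pi_element_pow: "pi_element G \<pi> x \<Longrightarrow> pi_element G \<pi> (x [^] (n::nat))"
proof -
  assume x: "pi_element G \<pi> x"
  then have xc: "x \<in> carrier G" by (rule pi_element_carrier)
  have "(x [^] n) [^] ord x = \<one>"
    using xc by (simp add: nat_pow_pow pow_eq_id)
  then have "ord (x [^] n) dvd ord x"
    using pow_eq_id xc by blast
  then have "q dvd ord x" if "q dvd ord (x [^] n)" for q using dvd_trans[OF that] by blast
  then show ?thesis using x xc unfolding pi_element_def by auto
qed

lemma pi_element_parts:
  "pi_element G \<pi> x \<Longrightarrow> pi_element G \<pi> (p_part p x)" "pi_element G \<pi> x \<Longrightarrow> pi_element G \<pi> (p'_part p x)"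
  by (simp_all add: p_part_def p'_part_def pi_element_pow)

lemma pi_element_mult:
  assumes "pi_element G \<pi> x" "pi_element G \<pi> y" "x \<otimes> y = y \<otimes> x"
  shows "pi_element G \<pi> (x \<otimes> y)"
proof -
  have xy: "x \<in> carrier G" "y \<in> carrier G" using assms pi_element_carrier by auto
  have "q \<in> \<pi>" if "Factorial_Ring.prime q" "q dvd ord (x \<otimes> y)" for q
  proof -
    have "q dvd ord x * ord y" using ord_mul_divides[OF assms(3) xy] that(2) dvd_trans by blast
    then have "q dvd ord x \<or> q dvd ord y" using that(1) prime_dvd_mult_iff by blast
    then show ?thesis using that(1) assms(1,2) unfolding pi_element_def by blast
  qed
  then show ?thesis using xy by (simp add: pi_element_def)
qed

lemma pi_element_conj:
  "pi_element G \<pi> x \<Longrightarrow> g \<in> carrier G \<Longrightarrow> pi_element G \<pi> (g \<otimes> x \<otimes> inv g)"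
  by (auto simp: pi_element_def ord_conj)

lemma pi_element_p_element:
  "Factorial_Ring.prime p \<Longrightarrow> p \<in> \<pi> \<Longrightarrow> p_element G p x \<Longrightarrow> pi_element G \<pi> x"
  unfolding pi_element_def p_element_def using prime_dvd_power primes_dvd_imp_eq by metis

lemma p_part_trivial:
  assumes "Factorial_Ring.prime q" "q \<notin> \<pi>" "pi_element G \<pi> x"
  shows "p_part q x = \<one>"
proof -
  have "\<not> q dvd ord x" using assms by (auto simp: pi_element_def)
  then have "p'_element G q x"
    using assms by (simp add: p'_element_def pi_element_carrier prime_imp_coprime)
  then show ?thesis using parts_p'_element(1)[OF assms(1)] by blast
qed

subsection \<open>Counting modulo a normal subgroup\<close>

text \<open>\<open>B\<close> is a disjoint union of cosets of \<open>A\<close>. The main use is that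
  the order of \<open>A\<close> divides the size of any set on which \<open>A\<close> acts by left
  multiplication.\<close>

lemma card_left_closed:
  assumes A: "subgroup A G" and B: "B \<subseteq> carrier G" and closed: "\<And>a x. a \<in> A \<Longrightarrow> x \<in> B \<Longrightarrow> a \<otimes> x \<in> B"
  shows "card A * card ((\<lambda>x. A #> x) ` B) = card B"
proof -
  let ?C = "(\<lambda>x. A #> x) ` B"
  have sub: "A \<subseteq> carrier G" using A subgroup.subset by blast
  have C: "?C \<subseteq> rcosets A" using B rcosetsI[OF sub] by blast
  have fin: "finite B" using B finite_subset_carrier by blast
  have U: "\<Union>?C = B"
  proof
    show "\<Union>?C \<subseteq> B" using closed by (auto simp: r_coset_def)
    show "B \<subseteq> \<Union>?C" using B rcos_self[OF _ A] by blast
  qed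
  have "card A * card ?C = card (\<Union>?C)"
  proof (rule card_partition)
    show "finite ?C" using fin by simp
    show "finite (\<Union>?C)" unfolding U by (rule fin)
    show "card c = card A" if "c \<in> ?C" for c using card_rcosets_equal[OF _ sub] that C by auto
    show "c \<inter> d = {}" if "c \<in> ?C" "d \<in> ?C" "c \<noteq> d" for c d
      using rcos_disjoint[OF A] that C unfolding pairwise_def disjnt_def by blast
  qed
  then show ?thesis using U by simp
qed

lemma rcoset_eq_iff:
  assumes "subgroup A G" "x \<in> carrier G" "y \<in> carrier G"
  shows "A #> x = A #> y \<longleftrightarrow> x \<in> A #> y"
  using assms repr_independence rcos_self by metis

lemma conj_rcoset:
  assumes A: "A \<lhd> G" and g: "g \<in> carrier G" and x: "x \<in> carrier G"
  shows "(\<lambda>y. g \<otimes> y \<otimes> inv g) ` (A #> x) = A #> (g \<otimes> x \<otimes> inv g)"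
proof
  interpret A: normal A G by (rule A)
  show "(\<lambda>y. g \<otimes> y \<otimes> inv g) ` (A #> x) \<subseteq> A #> (g \<otimes> x \<otimes> inv g)"
  proof
    fix z assume "z \<in> (\<lambda>y. g \<otimes> y \<otimes> inv g) ` (A #> x)"
    then obtain a where a: "a \<in> A" "z = g \<otimes> (a \<otimes> x) \<otimes> inv g" by (auto simp: r_coset_def)
    then have "z = (g \<otimes> a \<otimes> inv g) \<otimes> (g \<otimes> x \<otimes> inv g)"
      using conj_distrib[OF g A.mem_carrier[OF a(1)] x] by simp
    then show "z \<in> A #> (g \<otimes> x \<otimes> inv g)"
      using A.inv_op_closed2[OF g a(1)] by (auto simp: r_coset_def)
  qed
  show "A #> (g \<otimes> x \<otimes> inv g) \<subseteq> (\<lambda>y. g \<otimes> y \<otimes> inv g) ` (A #> x)"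
  proof
    fix z assume "z \<in> A #> (g \<otimes> x \<otimes> inv g)"
    then obtain a where a: "a \<in> A" "z = a \<otimes> (g \<otimes> x \<otimes> inv g)" by (auto simp: r_coset_def)
    let ?b = "inv g \<otimes> a \<otimes> g"
    have b: "?b \<in> A" using A.inv_op_closed1[OF g a(1)] .
    have "g \<otimes> ?b \<otimes> inv g = a" using g conj_inv_cancel(2)[OF g A.mem_carrier[OF a(1)]] by simp
    then have "z = g \<otimes> (?b \<otimes> x) \<otimes> inv g"
      using a(2) conj_distrib[OF g A.mem_carrier[OF b] x] by simp
    moreover have "?b \<otimes> x \<in> A #> x" using b by (auto simp: r_coset_def)
    ultimately show "z \<in> (\<lambda>y. g \<otimes> y \<otimes> inv g) ` (A #> x)" by blast
  qed
qed

text \<open>The fixed-point congruence for \<open>P\<close> conjugating the cosets of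
  \<open>A\<close> inside \<open>B\<close>; \<open>D\<close> is the union of the fixed cosets. The
  numbers \<open>b\<close> and \<open>d\<close> of cosets are compared, since a congruence between
  \<open>card B\<close> and \<open>card D\<close> says nothing when \<open>p\<close> divides
  \<open>card A\<close>.\<close>

lemma card_fixed_cosets_cong:
  assumes p: "Factorial_Ring.prime p" and P: "subgroup P G" "card P = p ^ n" and A: "A \<lhd> G"
    and B: "B \<subseteq> carrier G" "\<And>a x. a \<in> A \<Longrightarrow> x \<in> B \<Longrightarrow> a \<otimes> x \<in> B"
      "\<And>g x. g \<in> P \<Longrightarrow> x \<in> B \<Longrightarrow> g \<otimes> x \<otimes> inv g \<in> B"
  defines "D \<equiv> {x \<in> B. \<forall>g \<in> P. g \<otimes> x \<otimes> inv g \<in> A #> x}"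
  shows "\<exists>b d. card B = card A * b \<and> card D = card A * d \<and> b mod p = d mod p"
proof -
  define \<psi> where "\<psi> = (\<lambda>g R. (\<lambda>y. g \<otimes> y \<otimes> inv g) ` R)"
  let ?C = "\<lambda>x. A #> x"
  interpret A: normal A G by (rule A)
  interpret P: finite_group "G\<lparr>carrier := P\<rparr>" by (rule subgroup_finite_group[OF P(1)])
  have Ps: "\<And>g. g \<in> P \<Longrightarrow> g \<in> carrier G" by (rule subgroup.mem_carrier[OF P(1)])
  have Bs: "\<And>x. x \<in> B \<Longrightarrow> x \<in> carrier G" using B(1) by blast
  have \<psi>: "\<psi> g (?C x) = ?C (g \<otimes> x \<otimes> inv g)" if "g \<in> P" "x \<in> B" for g x
    unfolding \<psi>_def using conj_rcoset[OF A] Ps Bs that by blast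
  have fix_iff: "\<psi> g (?C x) = ?C x \<longleftrightarrow> g \<otimes> x \<otimes> inv g \<in> ?C x" if "g \<in> P" "x \<in> B" for g x
    using \<psi>[OF that] rcoset_eq_iff[OF A.subgroup_axioms] Ps Bs B(3) that by auto
  have "[card (?C ` B) = card {R \<in> ?C ` B. \<forall>g \<in> carrier (G\<lparr>carrier := P\<rparr>). \<psi> g R = R}] (mod p)"
  proof (rule P.card_fixed_points_cong[OF _ p])
    show "finite (?C ` B)" using B(1) finite_subset_carrier by blast
    show "order (G\<lparr>carrier := P\<rparr>) = p ^ n" using P(2) by (simp add: order_def)
    show "\<psi> g R \<in> ?C ` B" if "g \<in> carrier (G\<lparr>carrier := P\<rparr>)" "R \<in> ?C ` B" for g R
      using that \<psi> B(3) by auto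
    show "\<psi> \<one>\<^bsub>G\<lparr>carrier := P\<rparr>\<^esub> R = R" if "R \<in> ?C ` B" for R
      using that \<psi>[OF subgroup.one_closed[OF P(1)]] Bs by auto
    show "\<psi> (g \<otimes>\<^bsub>G\<lparr>carrier := P\<rparr>\<^esub> h) R = \<psi> g (\<psi> h R)"
      if "g \<in> carrier (G\<lparr>carrier := P\<rparr>)" "h \<in> carrier (G\<lparr>carrier := P\<rparr>)" "R \<in> ?C ` B" for g h R
    proof -
      obtain x where x: "x \<in> B" "R = ?C x" using \<open>R \<in> ?C ` B\<close> by blast
      have gh: "g \<in> P" "h \<in> P" "g \<otimes> h \<in> P" using that subgroup.m_closed[OF P(1)] by auto
      then show ?thesis
        using x \<psi> B(3) Ps Bs conj_mult[of g h x] by simp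
    qed
  qed
  moreover have "{R \<in> ?C ` B. \<forall>g \<in> carrier (G\<lparr>carrier := P\<rparr>). \<psi> g R = R} = ?C ` D"
    using fix_iff unfolding D_def by auto
  moreover have "card A * card (?C ` B) = card B"
    using card_left_closed[OF A.subgroup_axioms] B by blast
  moreover have "card A * card (?C ` D) = card D"
  proof (rule card_left_closed[OF A.subgroup_axioms])
    show "D \<subseteq> carrier G" using B(1) by (auto simp: D_def)
    fix a x assume a: "a \<in> A" and x: "x \<in> D"
    have ax: "a \<otimes> x \<in> B" "x \<in> B" using a x B(2) by (auto simp: D_def)
    \<comment> \<open>Whether an element of \<open>B\<close> belongs to \<open>D\<close> depends
      only on its coset of \<open>A\<close>.\<close>
    have same: "?C (a \<otimes> x) = ?C x"
      using rcoset_eq_iff[OF A.subgroup_axioms] ax Bs a by (auto simp: r_coset_def)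
    have "g \<otimes> (a \<otimes> x) \<otimes> inv g \<in> ?C (a \<otimes> x)" if g: "g \<in> P" for g
    proof -
      have "\<psi> g (?C x) = ?C x" using fix_iff[OF g ax(2)] x g by (simp add: D_def)
      then show ?thesis using fix_iff[OF g ax(1)] same by simp
    qed
    then show "a \<otimes> x \<in> D" using ax by (simp add: D_def)
  qed
  ultimately show ?thesis unfolding cong_def by metis
qed

end

section \<open>The upper central series and coprime commutation\<close>

section \<open>The hypercentre\<close>

context finite_group
begin

lemma finite_group_Mod: "N \<lhd> G \<Longrightarrow> finite_group (G Mod N)"
  by (simp add: finite_group_def finite_group_axioms_def normal.factorgroup_is_group carrier_FactGroup)

text \<open>The link between the elementwise recursion and the centre of the factor group, through
  which statements about central elements apply to a term of the series.\<close>

lemma upper_central_Suc_Mod: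
  assumes N: "upper_central G i \<lhd> G"
  shows "upper_central G (Suc i) = {x \<in> carrier G. upper_central G i #> x \<in> centre (G Mod upper_central G i)}"
proof -
  interpret N: normal "upper_central G i" G by (rule N)
  have "upper_central G i #> (x \<otimes> y) = (upper_central G i #> x) <#> (upper_central G i #> y)"
    if "x \<in> carrier G" "y \<in> carrier G" for x y
    using N.rcos_sum[OF that] by simp
  then show ?thesis
    by (auto simp: centre_def carrier_FactGroup)
qed

text \<open>Each new term is the preimage of the centre of a factor group. That factor group exists
  because the previous term is normal, so being a subgroup and being normal are carried through one
  induction.\<close>

lemma upper_central_normal: "upper_central G i \<lhd> G"
proof (induction i)
  case 0
  then show ?case by (simp add: one_is_normal)
next
  case (Suc i)
  define N where "N = upper_central G i"
  interpret N: normal N G using Suc by (simp add: N_def)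
  interpret Q: finite_group "G Mod N" using finite_group_Mod N.normal_axioms by blast
  interpret h: group_hom G "G Mod N" "\<lambda>a. N #> a"
    by (rule group_hom.intro) (auto simp: group_axioms Q.is_group group_hom_axioms_def N.r_coset_hom_Mod)
  let ?Z = "{x \<in> carrier G. N #> x \<in> centre (G Mod N)}"
  have eq: "upper_central G (Suc i) = ?Z"
    using upper_central_Suc_Mod[OF Suc] by (simp add: N_def)
  have "subgroup ?Z G"
  proof (rule subgroupI)
    have "N #> \<one> \<in> centre (G Mod N)" using subgroup.one_closed[OF Q.centre_subgroup] h.hom_one by argo
    then show "?Z \<noteq> {}" by blast
    show "inv x \<in> ?Z" if "x \<in> ?Z" for x
      using that subgroup.m_inv_closed[OF Q.centre_subgroup, of "N #> x"] h.hom_inv[of x] by simp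
    show "x \<otimes> y \<in> ?Z" if "x \<in> ?Z" "y \<in> ?Z" for x y
      using that subgroup.m_closed[OF Q.centre_subgroup, of "N #> x" "N #> y"] h.hom_mult[of x y] by simp
  qed auto
  then show ?case unfolding eq
  proof (rule normal_invI)
    fix g x assume g: "g \<in> carrier G" and x: "x \<in> ?Z"
    let ?g = "N #> g" and ?x = "N #> x"
    have cl: "?g \<in> carrier (G Mod N)" "?x \<in> carrier (G Mod N)" using g x h.hom_closed by auto
    have "N #> (g \<otimes> x \<otimes> inv g) = ?g \<otimes>\<^bsub>G Mod N\<^esub> ?x \<otimes>\<^bsub>G Mod N\<^esub> inv\<^bsub>G Mod N\<^esub> ?g"
      using g x h.hom_mult[of "g \<otimes> x" "inv g"] h.hom_mult[of g x] h.hom_inv[of g] by simp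
    also have "\<dots> = ?x"
      using Q.conj_eq_iff[OF cl(1) cl(2) cl(2)] Q.centreD(2)[of ?x ?g] x cl by blast
    finally show "g \<otimes> x \<otimes> inv g \<in> ?Z" using g x by simp
  qed
qed

lemma upper_central_subgroup: "subgroup (upper_central G i) G"
  by (rule normal_imp_subgroup[OF upper_central_normal])

text \<open>The recursion in terms of conjugates. It allows conjugation by the whole group to be
  replaced by conjugation by a subgroup with the same orbits.\<close>

lemma upper_central_Suc_iff:
  "x \<in> upper_central G (Suc i) \<longleftrightarrow>
     x \<in> carrier G \<and> (\<forall>g \<in> carrier G. g \<otimes> x \<otimes> inv g \<in> upper_central G i #> x)"
proof -
  define N where "N = upper_central G i"
  have N: "subgroup N G" unfolding N_def by (rule upper_central_subgroup)
  have sub: "N \<subseteq> carrier G" by (rule subgroup.subset[OF N])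
  have "N #> (x \<otimes> g) = N #> (g \<otimes> x) \<longleftrightarrow> g \<otimes> x \<otimes> inv g \<in> N #> x"
    if x: "x \<in> carrier G" and g: "g \<in> carrier G" for x g
  proof -
    have 1: "N #> (x \<otimes> g) #> inv g = N #> x" "N #> (g \<otimes> x) #> inv g = N #> (g \<otimes> x \<otimes> inv g)"
      using x g sub by (simp_all add: coset_mult_assoc m_assoc)
    have 2: "N #> (g \<otimes> x \<otimes> inv g) #> g = N #> (g \<otimes> x)" "N #> x #> g = N #> (x \<otimes> g)"
      using x g sub by (simp_all add: coset_mult_assoc m_assoc)
    have "N #> (x \<otimes> g) = N #> (g \<otimes> x) \<longleftrightarrow> N #> (g \<otimes> x \<otimes> inv g) = N #> x"
      using 1 2 by metis
    also have "\<dots> \<longleftrightarrow> g \<otimes> x \<otimes> inv g \<in> N #> x"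
      using rcoset_eq_iff[OF N] x g by simp
    finally show ?thesis .
  qed
  then show ?thesis unfolding upper_central.simps N_def[symmetric] by auto
qed

lemma upper_central_mono_Suc: "upper_central G i \<subseteq> upper_central G (Suc i)"
proof
  interpret N: normal "upper_central G i" G by (rule upper_central_normal)
  fix x assume x: "x \<in> upper_central G i"
  then have xc: "x \<in> carrier G" by (rule N.mem_carrier)
  have "upper_central G i #> x = upper_central G i"
    using coset_join2[OF xc N.subgroup_axioms x] .
  then show "x \<in> upper_central G (Suc i)"
    unfolding upper_central_Suc_iff using xc N.inv_op_closed2[OF _ x] by simp
qed

text \<open>The terms increase and their sizes are bounded by the group order; a term of maximal
  size equals all later ones and contains all earlier ones.\<close>

lemma hypercentre_eq_upper_central:
  obtains k where "hypercentre G = upper_central G k" "upper_central G (Suc k) = upper_central G k"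
proof -
  have mono: "upper_central G i \<subseteq> upper_central G j" if "i \<le> j" for i j
    using lift_Suc_mono_le[of "upper_central G"] upper_central_mono_Suc that by blast
  have fin: "finite (upper_central G i)" for i
    using finite_subset_carrier[OF subgroup.subset[OF upper_central_subgroup]] .
  have bound: "card (upper_central G i) < Suc (order G)" for i
    using card_mono[OF finite_carrier subgroup.subset[OF upper_central_subgroup]] by (simp add: order_def less_Suc_eq_le)
  obtain k where k: "\<And>i. card (upper_central G i) \<le> card (upper_central G k)"
    using ex_has_greatest_nat[of "\<lambda>_. True" 0 "\<lambda>i. card (upper_central G i)" "Suc (order G)"] bound by auto
  have ge: "upper_central G i = upper_central G k" if "k \<le> i" for i
    using card_seteq[OF fin mono[OF that] k] by simp
  have "upper_central G i \<subseteq> upper_central G k" for i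
    using mono[of i "max i k"] ge[of "max i k"] by simp
  then have "hypercentre G = upper_central G k" unfolding hypercentre_def by blast
  then show thesis using that ge[of "Suc k"] by simp
qed

lemma hypercentre_normal: "hypercentre G \<lhd> G"
  using hypercentre_eq_upper_central upper_central_normal by metis

text \<open>\<open>c \<otimes> x\<close> is conjugate to \<open>x\<close>, so its
  \<open>m\<close>-th power is trivial, and as \<open>c\<close> is central this gives
  \<open>c [^] m = \<one>\<close>. Symmetrically \<open>inv c \<otimes> g\<close> is conjugate to
  \<open>g\<close>, so the order of \<open>c\<close> divides \<open>n\<close> as well.\<close>

lemma central_commutator_coprime:
  assumes x: "x \<in> carrier G" and g: "g \<in> carrier G" and c: "c \<in> centre G"
    and eq: "g \<otimes> x \<otimes> inv g = c \<otimes> x"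
    and m: "x [^] (m::nat) = \<one>" and n: "g [^] (n::nat) = \<one>" and co: "coprime m n"
  shows "c = \<one>"
proof -
  have cc: "c \<in> carrier G" using c by (rule centreD)
  have "(c \<otimes> x) [^] m = c [^] m"
    using pow_mult_distrib[OF centreD(2)[OF c x, symmetric] cc x, of m] m cc by simp
  moreover have "(c \<otimes> x) [^] m = \<one>"
    using conj_pow[OF g x, of m] m g unfolding eq by simp
  ultimately have 1: "ord c dvd m" using pow_eq_id[OF cc] by metis
  \<comment> \<open>The same commutator relation is now solved for a conjugate of \<open>g\<close>
    by \<open>x\<close>.\<close>
  have "g \<otimes> x = c \<otimes> x \<otimes> g"
    using conj_eq_iff[OF g x, of "c \<otimes> x"] eq cc x by simp
  also have "\<dots> = c \<otimes> (x \<otimes> g \<otimes> inv x) \<otimes> x" using cc x g by (simp add: m_assoc)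
  finally have "g \<otimes> x = c \<otimes> (x \<otimes> g \<otimes> inv x) \<otimes> x" .
  then have "g = c \<otimes> (x \<otimes> g \<otimes> inv x)"
    using right_cancel[of x g "c \<otimes> (x \<otimes> g \<otimes> inv x)"] cc x g by simp
  then have "inv c \<otimes> g = x \<otimes> g \<otimes> inv x" using cc x g inv_cancel_left(1) by (metis inv_closed m_closed)
  then have "(inv c \<otimes> g) [^] n = \<one>"
    using conj_pow[OF x g, of n] n x by simp
  moreover have "(inv c \<otimes> g) [^] n = inv c [^] n"
    using pow_mult_distrib[of "inv c" g n] centreD(2)[OF subgroup.m_inv_closed[OF centre_subgroup c] g] n cc g by simp
  ultimately have "ord (inv c) dvd n" using pow_eq_id[of "inv c" n] cc by simp
  then have 2: "ord c dvd n" using cc by simp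
  have "ord c = 1" using coprime_common_divisor_nat[OF co 1 2] by simp
  then show ?thesis using ord_eq_1[OF cc] by blast
qed

text \<open>If the commutator of two elements of coprime orders lies in \<open>Z\<^bsub>k+1\<^esub>\<close>, then it is
  central modulo \<open>Z\<^bsub>k\<^esub>\<close>, so its order there divides both orders; hence it descends to \<open>Z\<^bsub>k\<^esub>\<close>.\<close>
lemma hypercentral_commute_coprime:
  assumes x: "x \<in> hypercentre G" and g: "g \<in> carrier G" and co: "coprime (ord x) (ord g)"
  shows "g \<otimes> x = x \<otimes> g"
proof -
  obtain k where k: "hypercentre G = upper_central G k" using hypercentre_eq_upper_central by metis
  interpret H: normal "hypercentre G" G by (rule hypercentre_normal)
  have xc: "x \<in> carrier G" using x by (rule H.mem_carrier)
  define c where "c = g \<otimes> x \<otimes> inv g \<otimes> inv x"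
  have cc: "c \<in> carrier G" using g xc by (simp add: c_def)
  have ceq: "g \<otimes> x \<otimes> inv g = c \<otimes> x" using g xc by (simp add: c_def m_assoc)
  have ck: "c \<in> upper_central G k"
    unfolding c_def k[symmetric]
    by (rule H.m_closed[OF H.inv_op_closed2[OF g x] H.m_inv_closed[OF x]])
  have "c \<in> upper_central G j \<longrightarrow> c = \<one>" for j
  proof (induction j)
    case (Suc j)
    define N where "N = upper_central G j"
    interpret N: normal N G unfolding N_def by (rule upper_central_normal)
    interpret Q: finite_group "G Mod N" using finite_group_Mod N.normal_axioms by blast
    interpret h: group_hom G "G Mod N" "\<lambda>a. N #> a"
      by (rule group_hom.intro) (auto simp: group_axioms Q.is_group group_hom_axioms_def N.r_coset_hom_Mod)
    show ?case
    proof
      assume "c \<in> upper_central G (Suc j)"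
      then have cent: "N #> c \<in> centre (G Mod N)"
        unfolding upper_central_Suc_Mod[OF upper_central_normal] N_def by blast
      have "N #> c = \<one>\<^bsub>G Mod N\<^esub>"
      proof (rule Q.central_commutator_coprime[OF _ _ cent _ _ _ co])
        show "N #> x \<in> carrier (G Mod N)" "N #> g \<in> carrier (G Mod N)" using xc g h.hom_closed by auto
        show "(N #> x) [^]\<^bsub>G Mod N\<^esub> ord x = \<one>\<^bsub>G Mod N\<^esub>" "(N #> g) [^]\<^bsub>G Mod N\<^esub> ord g = \<one>\<^bsub>G Mod N\<^esub>"
          using h.hom_nat_pow[OF xc, of "ord x"] h.hom_nat_pow[OF g, of "ord g"] h.hom_one pow_ord_eq_1 xc g by simp_all
        show "(N #> g) \<otimes>\<^bsub>G Mod N\<^esub> (N #> x) \<otimes>\<^bsub>G Mod N\<^esub> inv\<^bsub>G Mod N\<^esub> (N #> g) = (N #> c) \<otimes>\<^bsub>G Mod N\<^esub> (N #> x)"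
          using h.hom_mult[of "g \<otimes> x" "inv g"] h.hom_mult[of g x] h.hom_inv[of g] h.hom_mult[of c x] ceq xc g cc
          by simp
      qed
      then have "N #> c = N" by simp
      then have "c \<in> N" using coset_join1[OF _ cc N.subgroup_axioms] by blast
      then show "c = \<one>" using Suc by (simp add: N_def)
    qed
  qed simp
  then have "c = \<one>" using ck by blast
  then have "g \<otimes> x \<otimes> inv g = x" using ceq xc by simp
  then show ?thesis using conj_eq_iff[OF g xc xc] by blast
qed

text \<open>Fixed points of \<open>P\<close> on the cosets of \<open>P \<inter> hypercentre G\<close> in \<open>P\<close> lie in the hypercentre,
  since conjugating by \<open>G\<close> moves an element of \<open>P\<close> no further than conjugating by \<open>P\<close>.\<close>
lemma hypercentral_if_classes_eq_orbits:
  assumes p: "Factorial_Ring.prime p" and P: "subgroup P G" "card P = p ^ n"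
    and cls: "\<And>x. x \<in> P \<Longrightarrow> conj_class G x = {g \<otimes> x \<otimes> inv g |g. g \<in> P}"
  shows "P \<lhd> G" "P \<subseteq> hypercentre G"
proof -
  have Pc: "\<And>x. x \<in> P \<Longrightarrow> x \<in> carrier G" by (rule subgroup.mem_carrier[OF P(1)])
  have conjP: "g \<otimes> x \<otimes> inv g \<in> P" if "g \<in> P" "x \<in> P" for g x
    using subgroup.m_closed[OF P(1)] subgroup.m_inv_closed[OF P(1)] that by simp
  show PN: "P \<lhd> G"
  proof (rule normal_invI[OF P(1)])
    fix g x assume g: "g \<in> carrier G" and x: "x \<in> P"
    have "g \<otimes> x \<otimes> inv g \<in> conj_class G x" using g unfolding conj_class_def by blast
    then show "g \<otimes> x \<otimes> inv g \<in> P" using cls[OF x] conjP x by auto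
  qed
  obtain k where k: "hypercentre G = upper_central G k" "upper_central G (Suc k) = upper_central G k"
    by (rule hypercentre_eq_upper_central)
  define R where "R = P \<inter> hypercentre G"
  have R: "R \<lhd> G" unfolding R_def using normal_subgroup_intersect[OF PN hypercentre_normal] .
  interpret R: normal R G by (rule R)
  define D where "D = {x \<in> P. \<forall>g \<in> P. g \<otimes> x \<otimes> inv g \<in> R #> x}"
  obtain b d where bd: "card P = card R * b" "card D = card R * d" "b mod p = d mod p"
    using card_fixed_cosets_cong[OF p P R subgroup.subset[OF P(1)], folded D_def] conjP
      subgroup.m_closed[OF P(1)] by (auto simp: R_def)
  have "D = R"
  proof
    show "R \<subseteq> D"
    proof
      fix x assume x: "x \<in> R"
      then have "R #> x = R" using coset_join2[OF R.mem_carrier[OF x] R.subgroup_axioms x] by simp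
      then show "x \<in> D" using x R.inv_op_closed2[OF Pc x] by (auto simp: D_def R_def)
    qed
    show "D \<subseteq> R"
    proof
      fix x assume x: "x \<in> D"
      then have xP: "x \<in> P" by (simp add: D_def)
      have "h \<otimes> x \<otimes> inv h \<in> upper_central G k #> x" if h: "h \<in> carrier G" for h
      proof -
        have "h \<otimes> x \<otimes> inv h \<in> conj_class G x" using h unfolding conj_class_def by blast
        then obtain g where "g \<in> P" "h \<otimes> x \<otimes> inv h = g \<otimes> x \<otimes> inv g" using cls[OF xP] by auto
        then have "h \<otimes> x \<otimes> inv h \<in> R #> x" using x by (simp add: D_def)
        then show ?thesis by (auto simp: r_coset_def R_def k(1))
      qed
      \<comment> \<open>Each \<open>G\<close>-conjugate of \<open>x\<close> is a
        \<open>P\<close>-conjugate and stays in the coset of \<open>x\<close>, so \<open>x\<close>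
        is one step higher in the series, which is stationary at \<open>k\<close>.\<close>
      then have "x \<in> upper_central G (Suc k)" unfolding upper_central_Suc_iff using Pc[OF xP] by blast
      then show "x \<in> R" unfolding k(2) using xP by (simp add: R_def k(1))
    qed
  qed
  then have "card R * d = card R * 1" using bd(2)[symmetric] by simp
  then have d: "d = 1" using subgroup_card_pos[OF R.subgroup_axioms] unfolding mult_cancel1 by simp
  \<comment> \<open>\<open>b\<close> is the index of \<open>R\<close> in \<open>P\<close>. It is a
    power of \<open>p\<close> and congruent to 1 modulo \<open>p\<close>, hence equal to 1.\<close>
  have "b dvd p ^ n" using bd(1) P(2) by (metis dvd_triv_right)
  then obtain j where j: "b = p ^ j" using divides_primepow_nat[OF p] by blast
  have "j = 0"
  proof (rule ccontr)
    assume "j \<noteq> 0"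
    then have "b mod p = 0" using j by (cases j) auto
    then show False using bd(3) d prime_gt_1_nat[OF p] by simp
  qed
  then have "card R = card P" using bd(1) j by simp
  then have "R = P"
    using card_subset_eq[of P R] finite_subset_carrier[OF subgroup.subset[OF P(1)]] by (auto simp: R_def)
  then show "P \<subseteq> hypercentre G" by (auto simp: R_def)
qed

section \<open>Sylow arithmetic of class sizes\<close>

section \<open>Class sizes and Sylow subgroups\<close>

text \<open>\<open>sylow_card p\<close> is the full \<open>p\<close>-part of the group order, so no
  subgroup order can contain a further factor \<open>p\<close>.\<close>

lemma sylow_multiplicity:
  assumes p: "Factorial_Ring.prime p" and K: "subgroup K G" and d: "sylow_card p * p dvd card K"
  shows False
proof -
  have "sylow_card p * p dvd sylow_card p * (order G div sylow_card p)"
    unfolding order_sylow_card[OF p] using subgroup_card_dvd[OF K] d by (metis dvd_trans)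
  moreover have "sylow_card p \<noteq> 0" using p by (simp add: sylow_card_def)
  ultimately have "p dvd order G div sylow_card p"
    using dvd_times_left_cancel_iff[of "sylow_card p"] by metis
  then show False using coprime_p_index[OF p] p coprime_absorb_left not_prime_unit by blast
qed

text \<open>Stated for any factorisation of the group order, so that it covers class sizes, with
  \<open>K\<close> a centralizer, as well as numbers of cosets.\<close>

lemma not_dvd_cofactor:
  assumes p: "Factorial_Ring.prime p" and n: "n * card K = order G" and K: "subgroup K G"
    and Q: "subgroup Q G" "card Q = sylow_card p" "Q \<subseteq> K"
  shows "\<not> p dvd n"
proof
  assume "p dvd n"
  moreover have "sylow_card p dvd card K" using subgroup_subset_card_dvd[OF Q(1) K Q(3)] Q(2) by simp
  ultimately have "sylow_card p * p dvd card (carrier G)"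
    using n mult_dvd_mono[of p n "sylow_card p" "card K"] by (simp add: order_def mult.commute)
  then show False using sylow_multiplicity[OF p subgroup_self] by blast
qed

lemma sylow_in_if_not_dvd_cofactor:
  assumes p: "Factorial_Ring.prime p" and n: "n * card K = order G" and K: "subgroup K G"
    and nd: "\<not> p dvd n"
  shows "\<exists>Q. subgroup Q G \<and> Q \<subseteq> K \<and> card Q = sylow_card p"
proof -
  have "n \<noteq> 0" "card K \<noteq> 0" using n order_pos subgroup_card_pos[OF K] by (metis mult_0 neq0_conv)+
  then have "multiplicity p (order G) = multiplicity p (card K)"
    using prime_elem_multiplicity_mult_distrib[of p n "card K"] p nd n
    by (simp add: not_dvd_imp_multiplicity_0)
  then show ?thesis using sylow_in[OF K p] by (simp add: sylow_card_def)
qed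

lemma ex_sylow: "Factorial_Ring.prime p \<Longrightarrow> \<exists>P. subgroup P G \<and> card P = sylow_card p"
  using sylow_in[OF subgroup_self] by (auto simp: sylow_card_def order_def)

lemma sylow_p_element:
  "\<lbrakk>Factorial_Ring.prime p; subgroup P G; card P = sylow_card p; x \<in> P\<rbrakk> \<Longrightarrow> p_element G p x"
  unfolding sylow_card_def by (rule p_elementI_subgroup)

lemma not_dvd_class_size:
  assumes p: "Factorial_Ring.prime p" and x: "x \<in> carrier G"
    and Q: "subgroup Q G" "card Q = sylow_card p" "Q \<subseteq> centralizer G x"
  shows "\<not> p dvd card (conj_class G x)"
  by (rule not_dvd_cofactor[OF p card_conj_class[OF x] centralizer_subgroup[OF x] Q])

lemma not_dvd_class_sizeI:
  assumes p: "Factorial_Ring.prime p" and x: "x \<in> carrier G"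
    and comm: "\<And>g. p_element G p g \<Longrightarrow> g \<otimes> x = x \<otimes> g"
  shows "\<not> p dvd card (conj_class G x)"
proof -
  obtain Q where Q: "subgroup Q G" "card Q = sylow_card p" using ex_sylow[OF p] by blast
  have "Q \<subseteq> centralizer G x"
    using sylow_p_element[OF p Q] comm p_element_carrier by (auto simp: centralizer_def)
  then show ?thesis using not_dvd_class_size[OF p x Q] by blast
qed

text \<open>If the class of \<open>x\<close> has \<open>p\<close>-power size, then \<open>G = C(x) P\<close> for every Sylow \<open>p\<close>-subgroup \<open>P\<close>.\<close>
lemma class_eq_sylow_orbit:
  assumes p: "Factorial_Ring.prime p" and x: "x \<in> carrier G" and k: "card (conj_class G x) = p ^ k"
    and P: "subgroup P G" "card P = sylow_card p"
  shows "conj_class G x = {g \<otimes> x \<otimes> inv g |g. g \<in> P}"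
proof -
  let ?C = "centralizer G x" and ?O = "{g \<otimes> x \<otimes> inv g |g. g \<in> P}"
  have C: "subgroup ?C G" by (rule centralizer_subgroup[OF x])
  have PC: "subgroup (P \<inter> ?C) G" by (rule subgroups_Inter_pair[OF P(1) C])
  have O: "card ?O * card (P \<inter> ?C) = sylow_card p"
    using card_conj_orbit[OF P(1) x] P(2) by simp
  obtain j where j: "card (P \<inter> ?C) = p ^ j"
    using subgroup_subset_card_dvd[OF PC P(1)] P(2) divides_primepow_nat[OF p] by (auto simp: sylow_card_def)
  \<comment> \<open>The product \<open>p ^ k * p ^ j\<close> divides the group order and so its
    \<open>p\<close>-part, which equals \<open>card ?O * p ^ j\<close>. Thus the orbit has at least
    \<open>p ^ k\<close> elements and fills the class.\<close>
  have "p ^ j dvd card ?C" using subgroup_subset_card_dvd[OF PC C] j by simp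
  then have "p ^ k * p ^ j dvd p ^ k * card ?C" by (rule mult_dvd_mono[OF dvd_refl])
  then have "p ^ k * p ^ j dvd sylow_card p * (order G div sylow_card p)"
    using card_conj_class[OF x] unfolding order_sylow_card[OF p] k by metis
  moreover have "coprime (p ^ k * p ^ j) (order G div sylow_card p)"
    using coprime_p_index[OF p] by simp
  ultimately have "p ^ k * p ^ j dvd sylow_card p" using coprime_dvd_mult_left_iff by blast
  then have "p ^ k * p ^ j \<le> card ?O * p ^ j"
    using O j dvd_imp_le[of "p ^ k * p ^ j" "sylow_card p"] p by (simp add: sylow_card_def prime_gt_0_nat)
  then have "p ^ k \<le> card ?O" using p by (simp add: prime_gt_0_nat)
  moreover have "?O \<subseteq> conj_class G x"
    using subgroup.subset[OF P(1)] unfolding conj_class_def by blast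
  ultimately show ?thesis
    using card_seteq[of "conj_class G x" ?O] k finite_subset_carrier[OF conj_class_subset[OF x]] by simp
qed

text \<open>Some conjugate of \<open>x\<close> lies in \<open>P\<close>. The class of
  \<open>x\<close> is a single \<open>P\<close>-orbit, so the conjugating element can be taken in
  \<open>P\<close>, and undoing the conjugation stays in \<open>P\<close>.\<close>

lemma p_element_in_sylow_if_p_power_class:
  assumes p: "Factorial_Ring.prime p" and x: "p_element G p x" and k: "card (conj_class G x) = p ^ k"
    and P: "subgroup P G" "card P = sylow_card p"
  shows "x \<in> P"
proof -
  have xc: "x \<in> carrier G" using x by (rule p_element_carrier)
  have "\<not> p dvd card (rcosets P)"
    by (rule not_dvd_cofactor[OF p lagrange[OF P(1)] P(1) P(1,2) subset_refl])
  then obtain g where g: "g \<in> carrier G" "g \<otimes> x \<otimes> inv g \<in> P"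
    using p_element_conj_in[OF p P(1) _ x] by blast
  have "g \<otimes> x \<otimes> inv g \<in> conj_class G x" using g(1) unfolding conj_class_def by blast
  then obtain h where h: "h \<in> P" "h \<otimes> x \<otimes> inv h \<in> P"
    using class_eq_sylow_orbit[OF p xc k P] g(2) by auto
  have hc: "h \<in> carrier G" by (rule subgroup.mem_carrier[OF P(1) h(1)])
  have "inv h \<otimes> (h \<otimes> x \<otimes> inv h) \<otimes> inv (inv h) \<in> P"
    using h subgroup.m_inv_closed[OF P(1)] subgroup.m_closed[OF P(1)] by simp
  then show ?thesis using conj_inv_cancel(1)[OF hc xc] by simp
qed

end

section \<open>Sets of \<open>\<pi>\<close>-elements determined by the class counts\<close>

section \<open>Counting elements by class size\<close>

text \<open>The predicate on class sizes turns the sets \<open>A\<close>, \<open>B\<close>,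
  \<open>Z\<close> and \<open>S\<close> into instances of one family, so that a single counting
  argument transfers all of them between groups.\<close>

definition class_size_elements :: "('a, 'b) monoid_scheme \<Rightarrow> nat set \<Rightarrow> (nat \<Rightarrow> bool) \<Rightarrow> 'a set" where
  "class_size_elements G \<pi> \<phi> = {x. pi_element G \<pi> x \<and> \<phi> (card (conj_class G x))}"

context finite_group
begin

lemma class_size_elements_subset: "class_size_elements G \<pi> \<phi> \<subseteq> carrier G"
  by (auto simp: class_size_elements_def pi_element_carrier)

lemma finite_class_size_elements: "finite (class_size_elements G \<pi> \<phi>)"
  by (rule finite_subset_carrier[OF class_size_elements_subset])

text \<open>The elements in question are the disjoint union of the counted classes.\<close>

lemma card_class_size_elements_eq:
  "card (class_size_elements G \<pi> (\<lambda>m. m = n)) = n * num_pi_classes_of_size G \<pi> n"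
proof -
  let ?C = "{C. \<exists>x. pi_element G \<pi> x \<and> C = conj_class G x \<and> card C = n}"
  have U: "\<Union>?C = class_size_elements G \<pi> (\<lambda>m. m = n)"
  proof
    show "\<Union>?C \<subseteq> class_size_elements G \<pi> (\<lambda>m. m = n)"
    proof
      fix y assume "y \<in> \<Union>?C"
      then obtain x where x: "pi_element G \<pi> x" "y \<in> conj_class G x" "card (conj_class G x) = n" by blast
      then have "conj_class G y = conj_class G x"
        using conj_class_eqI[OF pi_element_carrier] by blast
      moreover have "pi_element G \<pi> y" using x pi_element_conj by (auto simp: conj_class_def)
      ultimately show "y \<in> class_size_elements G \<pi> (\<lambda>m. m = n)"
        using x(3) by (simp add: class_size_elements_def)
    qed
    show "class_size_elements G \<pi> (\<lambda>m. m = n) \<subseteq> \<Union>?C"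
      using conj_class_self[OF pi_element_carrier] by (auto simp: class_size_elements_def)
  qed
  have "?C \<subseteq> Pow (carrier G)"
    using conj_class_subset[OF pi_element_carrier] by auto
  then have "finite ?C" by (rule finite_subset) simp
  then have "n * card ?C = card (\<Union>?C)"
  proof (rule card_partition)
    show "finite (\<Union>?C)" unfolding U by (rule finite_class_size_elements)
    show "card c = n" if "c \<in> ?C" for c using that by blast
    show "c \<inter> d = {}" if cd: "c \<in> ?C" "d \<in> ?C" "c \<noteq> d" for c d
    proof (rule ccontr)
      assume "c \<inter> d \<noteq> {}"
      then obtain y where y: "y \<in> c" "y \<in> d" by blast
      obtain x where x: "pi_element G \<pi> x" "c = conj_class G x" using cd(1) by blast
      obtain z where z: "pi_element G \<pi> z" "d = conj_class G z" using cd(2) by blast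
      have "conj_class G y = c" "conj_class G y = d"
        using y conj_class_eqI[OF pi_element_carrier[OF x(1)]] conj_class_eqI[OF pi_element_carrier[OF z(1)]]
        unfolding x(2) z(2) by blast+
      then show False using cd(3) by simp
    qed
  qed
  then show ?thesis unfolding U num_pi_classes_of_size_def by simp
qed

text \<open>The bound \<open>M\<close> is left free so that groups of different orders can be summed
  over the same range. The range starts at 1 because classes are nonempty.\<close>

lemma card_class_size_elements:
  assumes M: "order G \<le> M"
  shows "card (class_size_elements G \<pi> \<phi>) = (\<Sum>n \<in> {n \<in> {1..M}. \<phi> n}. n * num_pi_classes_of_size G \<pi> n)"
proof -
  let ?N = "{n \<in> {1..M}. \<phi> n}"
  have "class_size_elements G \<pi> \<phi> = (\<Union>n \<in> ?N. class_size_elements G \<pi> (\<lambda>m. m = n))"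
  proof -
    have "card (conj_class G x) \<in> {1..M}" if "pi_element G \<pi> x" for x
      using conj_class_pos[OF pi_element_carrier[OF that]]
        card_mono[OF finite_carrier conj_class_subset[OF pi_element_carrier[OF that]]] M
      by (simp add: order_def)
    then show ?thesis by (auto simp: class_size_elements_def)
  qed
  moreover have "card (\<Union>n \<in> ?N. class_size_elements G \<pi> (\<lambda>m. m = n))
      = (\<Sum>n \<in> ?N. card (class_size_elements G \<pi> (\<lambda>m. m = n)))"
    by (rule card_UN_disjoint) (auto simp: finite_class_size_elements, auto simp: class_size_elements_def)
  ultimately show ?thesis by (simp add: card_class_size_elements_eq)
qed

text \<open>The elements of a Sylow \<open>p\<close>-subgroup of \<open>K\<close> are
  \<open>p\<close>-elements and \<open>p'\<close>-elements at once, hence trivial.\<close>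

lemma not_dvd_card_p'_subgroup:
  assumes p: "Factorial_Ring.prime p" and K: "subgroup K G" and el: "\<And>x. x \<in> K \<Longrightarrow> p'_element G p x"
  shows "\<not> p dvd card K"
proof
  assume "p dvd card K"
  then have pos: "multiplicity p (card K) > 0"
    using p prime_multiplicity_gt_zero_iff[of p "card K"] subgroup_card_pos[OF K] by simp
  obtain Q where Q: "subgroup Q G" "Q \<subseteq> K" "card Q = p ^ multiplicity p (card K)"
    using sylow_in[OF K p] by blast
  have "x = \<one>" if x: "x \<in> Q" for x
    using parts_p_element(1)[OF p p_elementI_subgroup[OF Q(1,3) p x]] parts_p'_element(1)[OF p el, of x] x Q(2)
    by auto
  then have "Q \<subseteq> {\<one>}" by blast
  then have "card Q \<le> 1" using card_mono[of "{\<one>}" Q] by simp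
  moreover have "p ^ multiplicity p (card K) > 1"
    using one_less_power[OF prime_gt_1_nat[OF p] pos] .
  ultimately show False using Q(3) by simp
qed

text \<open>Multiplication is a bijection from \<open>U \<times> V\<close> whose inverse takes the
  two parts; commutation ensures that \<open>u\<close> and \<open>v\<close> are the parts of their
  product.\<close>

lemma card_parts_product:
  assumes p: "Factorial_Ring.prime p"
    and U: "\<And>u. u \<in> U \<Longrightarrow> p_element G p u" and V: "\<And>v. v \<in> V \<Longrightarrow> p'_element G p v"
    and comm: "\<And>u v. u \<in> U \<Longrightarrow> v \<in> V \<Longrightarrow> u \<otimes> v = v \<otimes> u"
  shows "card {x \<in> carrier G. p_part p x \<in> U \<and> p'_part p x \<in> V} = card U * card V"
proof -
  have "bij_betw (\<lambda>(u, v). u \<otimes> v) (U \<times> V) {x \<in> carrier G. p_part p x \<in> U \<and> p'_part p x \<in> V}"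
  proof (rule bij_betw_byWitness[where f' = "\<lambda>x. (p_part p x, p'_part p x)"])
    have parts: "p_part p (u \<otimes> v) = u" "p'_part p (u \<otimes> v) = v" if "u \<in> U" "v \<in> V" for u v
      using parts_of_mult[OF p U V comm] that by auto
    then show "\<forall>a \<in> U \<times> V. (p_part p (case a of (u, v) \<Rightarrow> u \<otimes> v), p'_part p (case a of (u, v) \<Rightarrow> u \<otimes> v)) = a"
      by auto
    show "(\<lambda>(u, v). u \<otimes> v) ` (U \<times> V) \<subseteq> {x \<in> carrier G. p_part p x \<in> U \<and> p'_part p x \<in> V}"
      using parts p_element_carrier[OF U] p'_element_carrier[OF V] by auto
  qed (auto simp: parts_mult[OF p])
  then have "card (U \<times> V) = card {x \<in> carrier G. p_part p x \<in> U \<and> p'_part p x \<in> V}"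
    by (rule bij_betw_same_card)
  then show ?thesis by (simp add: card_cartesian_product)
qed

lemma pi_element_parts_iff:
  assumes p: "Factorial_Ring.prime p" and x: "x \<in> carrier G"
  shows "pi_element G \<pi> x \<longleftrightarrow> pi_element G \<pi> (p_part p x) \<and> pi_element G \<pi> (p'_part p x)"
proof -
  have "pi_element G \<pi> x" if "pi_element G \<pi> (p_part p x)" "pi_element G \<pi> (p'_part p x)"
    using pi_element_mult[OF that parts_commute[OF p x]] parts_mult[OF p x] by simp
  then show ?thesis using pi_element_parts by blast
qed

lemma centre_parts_iff:
  assumes p: "Factorial_Ring.prime p" and x: "x \<in> carrier G"
  shows "x \<in> centre G \<longleftrightarrow> p_part p x \<in> centre G \<and> p'_part p x \<in> centre G"
proof -
  have "x \<in> centre G" if "p_part p x \<in> centre G" "p'_part p x \<in> centre G"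
    using subgroup.m_closed[OF centre_subgroup that] parts_mult[OF p x] by simp
  then show ?thesis using subgroup_parts[OF p centre_subgroup] by blast
qed

abbreviation (input) pi_p_elements :: "nat set \<Rightarrow> nat \<Rightarrow> 'a set" where
  "pi_p_elements \<pi> p \<equiv> {x. pi_element G \<pi> x \<and> p_element G p x}"

abbreviation (input) pi_p'_elements :: "nat set \<Rightarrow> nat \<Rightarrow> 'a set" where
  "pi_p'_elements \<pi> p \<equiv> {x. pi_element G \<pi> x \<and> p'_element G p x}"

lemma class_size_1: "class_size_elements G \<pi> (\<lambda>n. n = 1) = {x. pi_element G \<pi> x \<and> x \<in> centre G}"
  using conj_class_card_eq_1_iff[OF pi_element_carrier] unfolding class_size_elements_def by auto

text \<open>Being a \<open>\<pi>\<close>-element and being central can both be tested on the parts,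
  and central elements commute, so the product count applies.\<close>

lemma card_pi_centre:
  assumes p: "Factorial_Ring.prime p"
  shows "card (class_size_elements G \<pi> (\<lambda>n. n = 1))
    = card (pi_p_elements \<pi> p \<inter> centre G) * card (pi_p'_elements \<pi> p \<inter> centre G)"
proof -
  have "pi_element G \<pi> x \<and> x \<in> centre G \<longleftrightarrow>
      p_part p x \<in> pi_p_elements \<pi> p \<inter> centre G \<and> p'_part p x \<in> pi_p'_elements \<pi> p \<inter> centre G"
    if x: "x \<in> carrier G" for x
    unfolding pi_element_parts_iff[OF p x, of \<pi>] centre_parts_iff[OF p x]
    using p_element_p_part[OF p x] p'_element_p'_part[OF p x] by blast
  then have eq: "class_size_elements G \<pi> (\<lambda>n. n = 1)
      = {x \<in> carrier G. p_part p x \<in> pi_p_elements \<pi> p \<inter> centre G \<and> p'_part p x \<in> pi_p'_elements \<pi> p \<inter> centre G}"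
    unfolding class_size_1 using pi_element_carrier[of \<pi>] by blast
  show ?thesis
    unfolding eq
  proof (rule card_parts_product[OF p])
    show "u \<otimes> v = v \<otimes> u"
      if "u \<in> pi_p_elements \<pi> p \<inter> centre G" "v \<in> pi_p'_elements \<pi> p \<inter> centre G" for u v
      using centreD(2)[of v u] p_element_carrier[of p u] that by blast
  qed blast+
qed

lemma pi_element_one: "pi_element G \<pi> \<one>"
  by (auto simp: pi_element_def)

lemma pi_p'_centre_subgroup:
  assumes p: "Factorial_Ring.prime p"
  shows "subgroup (pi_p'_elements \<pi> p \<inter> centre G) G"
proof (rule subgroupI)
  have "\<one> \<in> pi_p'_elements \<pi> p \<inter> centre G"
    using pi_element_one subgroup.one_closed[OF centre_subgroup] by (simp add: p'_element_def)
  then show "pi_p'_elements \<pi> p \<inter> centre G \<noteq> {}" by blast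
  show "inv x \<in> pi_p'_elements \<pi> p \<inter> centre G" if "x \<in> pi_p'_elements \<pi> p \<inter> centre G" for x
    using that subgroup.m_inv_closed[OF centre_subgroup] by (auto simp: p'_element_def pi_element_def)
  show "x \<otimes> y \<in> pi_p'_elements \<pi> p \<inter> centre G"
    if x: "x \<in> pi_p'_elements \<pi> p \<inter> centre G" and y: "y \<in> pi_p'_elements \<pi> p \<inter> centre G" for x y
  proof -
    have xy: "x \<in> carrier G" "y \<in> carrier G" "x \<otimes> y = y \<otimes> x"
      using x y p'_element_carrier centreD(2)[of y x] by blast+
    have "coprime p (ord x * ord y)" using x y by (simp add: p'_element_def)
    then have "coprime p (ord (x \<otimes> y))"
      using ord_mul_divides[OF xy(3,1,2)] by (rule coprime_divisors[OF dvd_refl, rotated])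
    then show ?thesis
      using x y xy subgroup.m_closed[OF centre_subgroup] pi_element_mult by (auto simp: p'_element_def)
  qed
qed (auto simp: p'_element_def)

lemma pi_p_centre_subgroup:
  assumes p: "Factorial_Ring.prime p"
  shows "subgroup (pi_p_elements \<pi> p \<inter> centre G) G"
proof (rule subgroupI)
  have "\<one> \<in> pi_p_elements \<pi> p \<inter> centre G"
    using pi_element_one subgroup.one_closed[OF centre_subgroup] p_element_iff[OF p] by simp
  then show "pi_p_elements \<pi> p \<inter> centre G \<noteq> {}" by blast
  show "inv x \<in> pi_p_elements \<pi> p \<inter> centre G" if "x \<in> pi_p_elements \<pi> p \<inter> centre G" for x
    using that subgroup.m_inv_closed[OF centre_subgroup] by (auto simp: p_element_def pi_element_def)
  show "x \<otimes> y \<in> pi_p_elements \<pi> p \<inter> centre G"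
    if x: "x \<in> pi_p_elements \<pi> p \<inter> centre G" and y: "y \<in> pi_p_elements \<pi> p \<inter> centre G" for x y
  proof -
    have xy: "x \<in> carrier G" "y \<in> carrier G" "x \<otimes> y = y \<otimes> x"
      using x y p_element_carrier centreD(2)[of y x] by blast+
    \<comment> \<open>A common exponent for all \<open>p\<close>-elements; as \<open>x\<close> and
      \<open>y\<close> commute, it annihilates their product too.\<close>
    have "x [^] sylow_card p = \<one>" "y [^] sylow_card p = \<one>"
      using x y p_element_iff[OF p] xy pow_eq_id by auto
    then have "(x \<otimes> y) [^] sylow_card p = \<one>"
      using pow_mult_distrib[OF xy(3,1,2)] by simp
    then have "p_element G p (x \<otimes> y)"
      using p_element_iff[OF p] pow_eq_id xy by simp
    then show ?thesis
      using x y xy subgroup.m_closed[OF centre_subgroup] pi_element_mult by auto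
  qed
qed (auto simp: p_element_def)

lemma pi_p'_centre_not_dvd:
  assumes p: "Factorial_Ring.prime p"
  shows "\<not> p dvd card (pi_p'_elements \<pi> p \<inter> centre G)"
  by (rule not_dvd_card_p'_subgroup[OF p pi_p'_centre_subgroup[OF p]]) blast

section \<open>Class sizes when a Hall \<open>\<pi>\<close>-subgroup is hypercentral\<close>

section \<open>Groups with a hypercentral Hall subgroup\<close>

text \<open>By primary parts: for \<open>q \<in> \<pi>\<close> the index of \<open>P\<close> is
  prime to \<open>q\<close>, so the \<open>q\<close>-part has a conjugate in \<open>P\<close>, and
  the hypercentre is normal; for other \<open>q\<close> the \<open>q\<close>-part is
  trivial.\<close>

lemma pi_element_hypercentral:
  assumes P: "hall_pi_subgroup P G \<pi>" "P \<subseteq> hypercentre G" and x: "pi_element G \<pi> x"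
  shows "x \<in> hypercentre G"
proof (rule mem_subgroup_if_parts_mem)
  interpret H: normal "hypercentre G" G by (rule hypercentre_normal)
  show "subgroup (hypercentre G) G" by (rule H.subgroup_axioms)
  show xc: "x \<in> carrier G" using x by (rule pi_element_carrier)
  fix q :: nat assume q: "Factorial_Ring.prime q"
  show "p_part q x \<in> hypercentre G"
  proof (cases "q \<in> \<pi>")
    case True
    have sub: "subgroup P G" "\<not> q dvd card (rcosets P)" using P(1) q True unfolding hall_pi_subgroup_def by blast+
    have yc: "p_part q x \<in> carrier G" by (rule parts_closed(1)[OF q xc])
    obtain g where g: "g \<in> carrier G" "g \<otimes> p_part q x \<otimes> inv g \<in> hypercentre G"
      using p_element_conj_in[OF q sub p_element_p_part[OF q xc]] P(2) by blast
    have "inv g \<otimes> (g \<otimes> p_part q x \<otimes> inv g) \<otimes> inv (inv g) \<in> hypercentre G"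
      by (rule H.inv_op_closed2[OF inv_closed[OF g(1)] g(2)])
    then show ?thesis using conj_inv_cancel(1)[OF g(1) yc] by simp
  next
    case False
    then show ?thesis using p_part_trivial[OF q _ x] H.one_closed by simp
  qed
qed

text \<open>The orders are coprime, and whichever element is a \<open>\<pi>\<close>-element is
  hypercentral. The other one ranges over all of \<open>G\<close>, as is needed to determine
  complete class sizes.\<close>

lemma pi_p_p'_commute:
  assumes P: "hall_pi_subgroup P G \<pi>" "P \<subseteq> hypercentre G" and x: "p_element G p x" and y: "p'_element G p y"
    and xy: "pi_element G \<pi> x \<or> pi_element G \<pi> y"
  shows "x \<otimes> y = y \<otimes> x"
proof -
  have co: "coprime (ord x) (ord y)"
    using x y by (auto simp: p_element_def p'_element_def)
  show ?thesis
  proof (cases "pi_element G \<pi> x")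
    case True
    then show ?thesis
      using hypercentral_commute_coprime[OF pi_element_hypercentral[OF P True] p'_element_carrier[OF y] co] by simp
  next
    case False
    then have "pi_element G \<pi> y" using xy by blast
    then show ?thesis
      using hypercentral_commute_coprime[OF pi_element_hypercentral[OF P] p_element_carrier[OF x]] co
      by (simp add: coprime_commute)
  qed
qed

text \<open>For a prime \<open>q \<noteq> p\<close> all \<open>q\<close>-elements commute with
  \<open>x\<close>, so a full Sylow \<open>q\<close>-subgroup centralises \<open>x\<close> and
  \<open>q\<close> does not divide the class size.\<close>

lemma class_size_pi_p_element:
  assumes P: "hall_pi_subgroup P G \<pi>" "P \<subseteq> hypercentre G" and p: "Factorial_Ring.prime p"
    and x: "p_element G p x" "pi_element G \<pi> x"
  shows "\<exists>k. card (conj_class G x) = p ^ k"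
proof (rule prime_power_if_no_other_prime[OF p])
  have xc: "x \<in> carrier G" by (rule p_element_carrier[OF x(1)])
  show "card (conj_class G x) > 0" by (rule conj_class_pos[OF xc])
  fix q assume q: "Factorial_Ring.prime q" "q dvd card (conj_class G x)"
  show "q = p"
  proof (rule ccontr)
    assume "q \<noteq> p"
    then have "g \<otimes> x = x \<otimes> g" if "p_element G q g" for g
      using pi_p_p'_commute[OF P x(1) p'_element_if_p_element[OF p q(1) _ that]] x(2) by simp
    then show False using not_dvd_class_sizeI[OF q(1) xc] q(2) by blast
  qed
qed

lemma class_size_pi_p'_element:
  assumes P: "hall_pi_subgroup P G \<pi>" "P \<subseteq> hypercentre G" and p: "Factorial_Ring.prime p"
    and x: "p'_element G p x" "pi_element G \<pi> x"
  shows "\<not> p dvd card (conj_class G x)"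
  using not_dvd_class_sizeI[OF p p'_element_carrier[OF x(1)]] pi_p_p'_commute[OF P _ x(1)] x(2) by blast

text \<open>For \<open>q \<in> \<pi>\<close>, \<open>P\<close> contains a Sylow
  \<open>q\<close>-subgroup of \<open>G\<close>. The \<open>q\<close>-part of a
  \<open>\<pi>\<close>-element has \<open>q\<close>-power class size, so it lies in every Sylow
  \<open>q\<close>-subgroup and thus in \<open>P\<close>.\<close>

lemma hall_eq_pi_elements:
  assumes P: "hall_pi_subgroup P G \<pi>" "P \<subseteq> hypercentre G"
  shows "P = {x. pi_element G \<pi> x}"
proof
  have sub: "subgroup P G" using P(1) by (simp add: hall_pi_subgroup_def)
  show "P \<subseteq> {x. pi_element G \<pi> x}"
  proof
    fix x assume x: "x \<in> P"
    have "q \<in> \<pi>" if "Factorial_Ring.prime q" "q dvd ord x" for q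
    proof -
      have "q dvd card P" using that(2) ord_dvd_card_subgroup[OF sub x] by (rule dvd_trans)
      then show ?thesis using P(1) that(1) unfolding hall_pi_subgroup_def by blast
    qed
    then show "x \<in> {x. pi_element G \<pi> x}"
      using subgroup.mem_carrier[OF sub x] by (simp add: pi_element_def)
  qed
  show "{x. pi_element G \<pi> x} \<subseteq> P"
  proof
    fix x assume "x \<in> {x. pi_element G \<pi> x}"
    then have x: "pi_element G \<pi> x" by simp
    then have xc: "x \<in> carrier G" by (rule pi_element_carrier)
    show "x \<in> P"
    proof (rule mem_subgroup_if_parts_mem[OF sub xc])
      fix q :: nat assume q: "Factorial_Ring.prime q"
      show "p_part q x \<in> P"
      proof (cases "q \<in> \<pi>")
        case True
        then have "\<not> q dvd card (rcosets P)" using P(1) q unfolding hall_pi_subgroup_def by blast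
        then obtain Q where Q: "subgroup Q G" "Q \<subseteq> P" "card Q = sylow_card q"
          using sylow_in_if_not_dvd_cofactor[OF q lagrange[OF sub] sub] by blast
        have y: "p_element G q (p_part q x)" by (rule p_element_p_part[OF q xc])
        obtain k where "card (conj_class G (p_part q x)) = q ^ k"
          using class_size_pi_p_element[OF P q y pi_element_parts(1)[OF x]] by blast
        then have "p_part q x \<in> Q" using p_element_in_sylow_if_p_power_class[OF q y _ Q(1,3)] by blast
        then show ?thesis using Q(2) by blast
      next
        case False
        then show ?thesis using p_part_trivial[OF q _ x] subgroup.one_closed[OF sub] by simp
      qed
    qed
  qed
qed

text \<open>All four sets are products over parts: with \<open>?U\<close>, \<open>?V\<close> and the
  centre \<open>?C\<close>, \<open>S\<close> is \<open>?U\<close> times \<open>?V\<close>, and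
  making the second, the first or both factors central yields \<open>A\<close>, \<open>B\<close> or
  \<open>Z\<close>.\<close>

lemma hall_counts:
  assumes P: "hall_pi_subgroup P G \<pi>" "P \<subseteq> hypercentre G" and p: "Factorial_Ring.prime p" "p \<in> \<pi>"
  defines "A \<equiv> class_size_elements G \<pi> (\<lambda>n. \<exists>k. n = p ^ k)"
    and "B \<equiv> class_size_elements G \<pi> (\<lambda>n. \<not> p dvd n)"
    and "Z \<equiv> class_size_elements G \<pi> (\<lambda>n. n = 1)"
    and "S \<equiv> class_size_elements G \<pi> (\<lambda>n. True)"
  shows "card A * card B = card Z * card S"
    and "\<exists>s t. \<not> p dvd s \<and> \<not> p dvd t \<and> card B * t = card Z * s"
proof -
  let ?U = "pi_p_elements \<pi> p" and ?V = "pi_p'_elements \<pi> p" and ?C = "centre G"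
  have comm: "u \<otimes> v = v \<otimes> u" if "u \<in> ?U" "v \<in> ?V" for u v
    using pi_p_p'_commute[OF P] that by blast
  have prod: "card {x \<in> carrier G. p_part p x \<in> U \<and> p'_part p x \<in> V} = card U * card V"
    if "U \<subseteq> ?U" "V \<subseteq> ?V" for U V
    by (rule card_parts_product[OF p(1)]) (use that comm in blast)+
  have parts: "p_part p x \<in> ?U" "p'_part p x \<in> ?V" if "pi_element G \<pi> x" for x
    using pi_element_parts[OF that] p_element_p_part[OF p(1)] p'_element_p'_part[OF p(1)]
      pi_element_carrier[OF that] by auto
  have pi_iff: "pi_element G \<pi> x \<longleftrightarrow> x \<in> carrier G \<and> p_part p x \<in> ?U \<and> p'_part p x \<in> ?V" for x
    using parts[of x] pi_element_parts_iff[OF p(1), of x \<pi>] pi_element_carrier[of \<pi> x] by blast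
  have S: "S = {x \<in> carrier G. p_part p x \<in> ?U \<and> p'_part p x \<in> ?V}"
    unfolding S_def class_size_elements_def using pi_iff by blast
  have dvd: "card (conj_class G (p_part p x)) dvd card (conj_class G x)"
    "card (conj_class G (p'_part p x)) dvd card (conj_class G x)" if "pi_element G \<pi> x" for x
    using pi_element_carrier[OF that]
    by (auto intro!: conj_class_card_dvd centralizer_parts[OF p(1)] parts_closed[OF p(1)])
  \<comment> \<open>Multiplying \<open>y\<close> by a central element does not shrink its
    centralizer.\<close>
  have cent_left: "centralizer G y \<subseteq> centralizer G x" if "x \<in> carrier G" "u \<in> ?C" "y \<in> carrier G" "x = u \<otimes> y \<or> x = y \<otimes> u" for x y u
  proof
    fix g assume "g \<in> centralizer G y"
    then have g: "g \<in> carrier G" "y \<in> centralizer G g" using that(3) by (simp_all add: centralizer_def)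
    have "u \<in> centralizer G g" using centreD[OF that(2)] g(1) by (simp add: centralizer_def)
    then have "x \<in> centralizer G g"
      using subgroup.m_closed[OF centralizer_subgroup[OF g(1)]] g(2) that(4) by auto
    then show "g \<in> centralizer G x" using g(1) by (simp add: centralizer_def)
  qed
  \<comment> \<open>The class size of the \<open>p'\<close>-part is prime to \<open>p\<close>; if it
    also divides a power of \<open>p\<close>, it is 1. Conversely, a central \<open>p'\<close>-part
    makes the class size of \<open>x\<close> divide that of its \<open>p\<close>-part.\<close>
  have A_iff: "(\<exists>k. card (conj_class G x) = p ^ k) \<longleftrightarrow> p'_part p x \<in> ?C" if x: "pi_element G \<pi> x" for x
  proof
    have xc: "x \<in> carrier G" by (rule pi_element_carrier[OF x])
    assume "\<exists>k. card (conj_class G x) = p ^ k"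
    then obtain j where j: "card (conj_class G (p'_part p x)) = p ^ j"
      using dvd(2)[OF x] divides_primepow_nat[OF p(1)] by metis
    have "\<not> p dvd card (conj_class G (p'_part p x))"
      using class_size_pi_p'_element[OF P p(1)] parts(2)[OF x] by blast
    then have "j = 0" using j by (cases j) auto
    then show "p'_part p x \<in> ?C" using conj_class_card_eq_1_iff[OF parts_closed(2)[OF p(1) xc]] j by simp
  next
    have xc: "x \<in> carrier G" by (rule pi_element_carrier[OF x])
    assume c: "p'_part p x \<in> ?C"
    have "centralizer G (p_part p x) \<subseteq> centralizer G x"
      using cent_left[OF xc c parts_closed(1)[OF p(1) xc]] parts_mult[OF p(1) xc] by simp
    then have "card (conj_class G x) dvd card (conj_class G (p_part p x))"
      using conj_class_card_dvd xc parts_closed(1)[OF p(1) xc] by blast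
    moreover obtain k where "card (conj_class G (p_part p x)) = p ^ k"
      using class_size_pi_p_element[OF P p(1)] parts(1)[OF x] by blast
    ultimately show "\<exists>k. card (conj_class G x) = p ^ k"
      using divides_primepow_nat[OF p(1)] by metis
  qed
  \<comment> \<open>The mirror image: the class size of the \<open>p\<close>-part is a power of
    \<open>p\<close>, so it is 1 once it divides a number prime to \<open>p\<close>.\<close>
  have B_iff: "\<not> p dvd card (conj_class G x) \<longleftrightarrow> p_part p x \<in> ?C" if x: "pi_element G \<pi> x" for x
  proof
    have xc: "x \<in> carrier G" by (rule pi_element_carrier[OF x])
    assume nd: "\<not> p dvd card (conj_class G x)"
    obtain k where k: "card (conj_class G (p_part p x)) = p ^ k"
      using class_size_pi_p_element[OF P p(1)] parts(1)[OF x] by blast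
    have "k = 0"
    proof (rule ccontr)
      assume "k \<noteq> 0"
      then have "p dvd card (conj_class G (p_part p x))" using k by (cases k) auto
      then show False using dvd(1)[OF x] nd dvd_trans by metis
    qed
    then show "p_part p x \<in> ?C" using conj_class_card_eq_1_iff[OF parts_closed(1)[OF p(1) xc]] k by simp
  next
    have xc: "x \<in> carrier G" by (rule pi_element_carrier[OF x])
    assume c: "p_part p x \<in> ?C"
    have "centralizer G (p'_part p x) \<subseteq> centralizer G x"
      using cent_left[OF xc c parts_closed(2)[OF p(1) xc]] parts_mult[OF p(1) xc] by simp
    then have d: "card (conj_class G x) dvd card (conj_class G (p'_part p x))"
      using conj_class_card_dvd xc parts_closed(2)[OF p(1) xc] by blast
    have "\<not> p dvd card (conj_class G (p'_part p x))"
      using class_size_pi_p'_element[OF P p(1)] parts(2)[OF x] by blast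
    then show "\<not> p dvd card (conj_class G x)" using d dvd_trans by metis
  qed
  have A_eq: "A = {x \<in> carrier G. p_part p x \<in> ?U \<and> p'_part p x \<in> ?V \<inter> ?C}"
    unfolding A_def class_size_elements_def using A_iff pi_iff by blast
  have A: "card A = card ?U * card (?V \<inter> ?C)" unfolding A_eq by (rule prod) blast+
  have B_eq: "B = {x \<in> carrier G. p_part p x \<in> ?U \<inter> ?C \<and> p'_part p x \<in> ?V}"
    unfolding B_def class_size_elements_def using B_iff pi_iff by blast
  have B: "card B = card (?U \<inter> ?C) * card ?V" unfolding B_eq by (rule prod) blast+
  have Z: "card Z = card (?U \<inter> ?C) * card (?V \<inter> ?C)"
    unfolding Z_def by (rule card_pi_centre[OF p(1)])
  have S': "card S = card ?U * card ?V" unfolding S by (rule prod) blast+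
  show "card A * card B = card Z * card S" unfolding A B Z S' by simp
  have sub: "subgroup P G" and nd: "\<not> p dvd card (rcosets P)"
    using P(1) p unfolding hall_pi_subgroup_def by blast+
  obtain Q where Q: "subgroup Q G" "Q \<subseteq> P" "card Q = sylow_card p"
    using sylow_in_if_not_dvd_cofactor[OF p(1) lagrange[OF sub] sub nd] by blast
  \<comment> \<open>Once \<open>?U\<close> is a Sylow subgroup of \<open>G\<close>, the order of
    \<open>P\<close> is \<open>sylow_card p * card ?V\<close>, which forces \<open>card ?V\<close>
    to be prime to \<open>p\<close>.\<close>
  have "?U = Q"
  proof
    show "Q \<subseteq> ?U"
      using sylow_p_element[OF p(1) Q(1,3)] pi_element_p_element[OF p] by blast
    show "?U \<subseteq> Q"
    proof
      fix x assume x: "x \<in> ?U"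
      then obtain k where "card (conj_class G x) = p ^ k"
        using class_size_pi_p_element[OF P p(1)] by blast
      then show "x \<in> Q" using p_element_in_sylow_if_p_power_class[OF p(1) _ _ Q(1,3)] x by blast
    qed
  qed
  have "S = P" unfolding S_def class_size_elements_def using hall_eq_pi_elements[OF P] by simp
  then have P_card: "card P = sylow_card p * card ?V" using S' \<open>?U = Q\<close> Q(3) by simp
  have V: "\<not> p dvd card ?V"
  proof
    assume "p dvd card ?V"
    then have "sylow_card p * p dvd card P" unfolding P_card by (rule mult_dvd_mono[OF dvd_refl])
    then show False by (rule sylow_multiplicity[OF p(1) sub])
  qed
  \<comment> \<open>The witnesses are \<open>s = card ?V\<close> and
    \<open>t = card (?V \<inter> ?C)\<close>.\<close>
  have "card B * card (?V \<inter> ?C) = card Z * card ?V" unfolding B Z by simp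
  then show "\<exists>s t. \<not> p dvd s \<and> \<not> p dvd t \<and> card B * t = card Z * s"
    using V pi_p'_centre_not_dvd[OF p(1)] by blast
qed

end

section \<open>From the counts back to normal hypercentral Sylow subgroups\<close>

section \<open>Recovering the Hall subgroup from class sizes\<close>

text \<open>Coprime orders force a trivial intersection, so multiplication is injective on
  \<open>M \<times> N\<close>.\<close>

lemma (in finite_group) card_normal_product:
  assumes M: "M \<lhd> G" and N: "N \<lhd> G" and co: "coprime (card M) (card N)"
  shows "card (M <#> N) = card M * card N"
proof -
  interpret M: normal M G by (rule M)
  interpret N: normal N G by (rule N)
  have triv: "x = \<one>" if "x \<in> M" "x \<in> N" for x
  proof -
    have "ord x = 1"
      using coprime_common_divisor_nat[OF co] ord_dvd_card_subgroup[OF M.subgroup_axioms that(1)]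
        ord_dvd_card_subgroup[OF N.subgroup_axioms that(2)] by simp
    then show ?thesis using ord_eq_1[OF M.mem_carrier[OF that(1)]] by blast
  qed
  have "inj_on (\<lambda>(x, y). x \<otimes> y) (M \<times> N)"
  proof (rule inj_onI, clarify)
    fix x y x' y' assume x: "x \<in> M" "x' \<in> M" and y: "y \<in> N" "y' \<in> N" and eq: "x \<otimes> y = x' \<otimes> y'"
    have c: "x \<in> carrier G" "x' \<in> carrier G" "y \<in> carrier G" "y' \<in> carrier G"
      using x y M.mem_carrier N.mem_carrier by auto
    have "inv x' \<otimes> (x \<otimes> y) \<otimes> inv y = inv x' \<otimes> (x' \<otimes> y') \<otimes> inv y" using eq by simp
    then have e: "inv x' \<otimes> x = y' \<otimes> inv y" using c by (simp add: m_assoc inv_cancel_left)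
    have "inv x' \<otimes> x \<in> M" using x M.m_closed M.m_inv_closed by simp
    moreover have "inv x' \<otimes> x \<in> N" unfolding e using y N.m_closed N.m_inv_closed by simp
    ultimately have "inv x' \<otimes> x = \<one>" "y' \<otimes> inv y = \<one>" using triv e by auto
    then have "x' \<otimes> (inv x' \<otimes> x) = x'" "y' \<otimes> inv y \<otimes> y = y" using c by auto
    then show "x = x' \<and> y = y'" using c by (simp add: m_assoc inv_cancel_left)
  qed
  moreover have "(\<lambda>(x, y). x \<otimes> y) ` (M \<times> N) = M <#> N" by (auto simp: set_mult_def)
  ultimately have "card (M <#> N) = card (M \<times> N)" by (metis card_image)
  then show ?thesis by (simp add: card_cartesian_product)
qed

text \<open>The two arithmetic facts that pass from one group to the other. The cofactors
  \<open>s\<close> and \<open>t\<close>, both prime to \<open>p\<close>, express that two numbers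
  have the same \<open>p\<close>-part without mentioning valuations.\<close>

locale counted_group = finite_group +
  fixes \<pi> :: "nat set"
  assumes primes: "\<And>p. p \<in> \<pi> \<Longrightarrow> Factorial_Ring.prime p"
    and count_product: "\<And>p. p \<in> \<pi> \<Longrightarrow>
      card (class_size_elements G \<pi> (\<lambda>n. \<exists>k. n = p ^ k)) * card (class_size_elements G \<pi> (\<lambda>n. \<not> p dvd n))
        = card (class_size_elements G \<pi> (\<lambda>n. n = 1)) * card (class_size_elements G \<pi> (\<lambda>n. True))"
    and count_p': "\<And>p. p \<in> \<pi> \<Longrightarrow>
      \<exists>s t. \<not> p dvd s \<and> \<not> p dvd t \<and>
        card (class_size_elements G \<pi> (\<lambda>n. \<not> p dvd n)) * t = card (class_size_elements G \<pi> (\<lambda>n. n = 1)) * s"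
begin

text \<open>A Sylow subgroup \<open>P\<close> acts by conjugation on the elements of \<open>p'\<close>-class size modulo the
  central \<open>p\<close>-elements \<open>Z\<^sub>p\<close>. The fixed cosets consist of elements centralised by \<open>P\<close>, on which
  \<open>Z(P)\<close> acts freely by multiplication. As the number of cosets is prime to \<open>p\<close>, this forces
  \<open>Z(P) = Z\<^sub>p\<close>.\<close>
lemma sylow_centre_central:
  assumes p: "p \<in> \<pi>" and P: "subgroup P G" "card P = sylow_card p"
    and z: "z \<in> P" "P \<subseteq> centralizer G z"
  shows "z \<in> centre G"
proof -
  have pp: "Factorial_Ring.prime p" by (rule primes[OF p])
  have Pc: "\<And>x. x \<in> P \<Longrightarrow> x \<in> carrier G" by (rule subgroup.mem_carrier[OF P(1)])
  define B where "B = class_size_elements G \<pi> (\<lambda>n. \<not> p dvd n)"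
  define Zp where "Zp = {x. pi_element G \<pi> x \<and> p_element G p x} \<inter> centre G"
  define Z' where "Z' = {x. pi_element G \<pi> x \<and> p'_element G p x} \<inter> centre G"
  have Zp: "subgroup Zp G" unfolding Zp_def by (rule pi_p_centre_subgroup[OF pp])
  have Zc: "\<And>x. x \<in> Zp \<Longrightarrow> x \<in> centre G" by (simp add: Zp_def)
  have ZN: "Zp \<lhd> G"
  proof (rule normal_invI[OF Zp])
    fix g x assume g: "g \<in> carrier G" and x: "x \<in> Zp"
    then show "g \<otimes> x \<otimes> inv g \<in> Zp"
      using conj_eq_iff[OF g, of x x] centreD[OF Zc[OF x]] by simp
  qed
  have Bpi: "\<And>x. x \<in> B \<Longrightarrow> pi_element G \<pi> x" by (simp add: B_def class_size_elements_def)
  have Bc: "\<And>x. x \<in> B \<Longrightarrow> x \<in> carrier G" using Bpi pi_element_carrier by blast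
  have BI: "x \<in> B" if "pi_element G \<pi> x" "\<not> p dvd card (conj_class G x)" for x
    using that by (simp add: B_def class_size_elements_def)
  have Bd: "\<not> p dvd card (conj_class G x)" if "x \<in> B" for x
    using that by (simp add: B_def class_size_elements_def)
  have B_mult: "z \<otimes> x \<in> B" if z: "z \<in> Zp" and x: "x \<in> B" for z x
  proof (rule BI)
    have zc: "z \<in> carrier G" by (rule centreD(1)[OF Zc[OF z]])
    have comm: "z \<otimes> x = x \<otimes> z" using centreD(2)[OF Zc[OF z] Bc[OF x]] by simp
    show "pi_element G \<pi> (z \<otimes> x)" using z Bpi[OF x] comm by (intro pi_element_mult) (auto simp: Zp_def)
    have "centralizer G x \<subseteq> centralizer G (z \<otimes> x)"
    proof
      fix g assume "g \<in> centralizer G x"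
      then have g: "g \<in> carrier G" "x \<in> centralizer G g" using Bc[OF x] by (simp_all add: centralizer_def)
      have "z \<in> centralizer G g" using centreD[OF Zc[OF z]] g(1) by (simp add: centralizer_def)
      then have "z \<otimes> x \<in> centralizer G g"
        using subgroup.m_closed[OF centralizer_subgroup[OF g(1)] _ g(2)] by blast
      then show "g \<in> centralizer G (z \<otimes> x)" using g(1) by (simp add: centralizer_def)
    qed
    then have "card (conj_class G (z \<otimes> x)) dvd card (conj_class G x)"
      using conj_class_card_dvd[OF Bc[OF x]] zc Bc[OF x] by simp
    then show "\<not> p dvd card (conj_class G (z \<otimes> x))" using Bd[OF x] dvd_trans by metis
  qed
  have B_conj: "g \<otimes> x \<otimes> inv g \<in> B" if g: "g \<in> P" and x: "x \<in> B" for g x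
  proof (rule BI)
    show "pi_element G \<pi> (g \<otimes> x \<otimes> inv g)" by (rule pi_element_conj[OF Bpi[OF x] Pc[OF g]])
    have "g \<otimes> x \<otimes> inv g \<in> conj_class G x" using Pc[OF g] unfolding conj_class_def by blast
    then show "\<not> p dvd card (conj_class G (g \<otimes> x \<otimes> inv g))"
      using conj_class_eqI[OF Bc[OF x]] Bd[OF x] by simp
  qed
  define D where "D = {x \<in> B. \<forall>g \<in> P. g \<otimes> x \<otimes> inv g \<in> Zp #> x}"
  obtain b d where bd: "card B = card Zp * b" "card D = card Zp * d" "b mod p = d mod p"
    using card_fixed_cosets_cong[OF pp P(1) P(2)[unfolded sylow_card_def] ZN _ B_mult B_conj, folded D_def]
      Bc by blast
  have D_cent: "P \<subseteq> centralizer G x" if x: "x \<in> D" for x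
  proof
    fix g assume g: "g \<in> P"
    have xB: "x \<in> B" using x by (simp add: D_def)
    have xc: "x \<in> carrier G" by (rule Bc[OF xB])
    have gc: "g \<in> carrier G" by (rule Pc[OF g])
    obtain z where z: "z \<in> Zp" "g \<otimes> x \<otimes> inv g = z \<otimes> x"
      using x g by (auto simp: D_def r_coset_def)
    have zC: "z \<in> centre G" by (rule Zc[OF z(1)])
    have zc: "z \<in> carrier G" by (rule centreD(1)[OF zC])
    \<comment> \<open>As \<open>z\<close> is central and \<open>z \<otimes> x\<close> is a conjugate
      of \<open>x\<close>, left multiplication by \<open>z\<close> maps the class of
      \<open>x\<close> into itself.\<close>
    have step: "z \<otimes> y \<in> conj_class G x" if y: "y \<in> conj_class G x" for y
    proof -
      obtain h where h: "h \<in> carrier G" "y = h \<otimes> x \<otimes> inv h" using y by (auto simp: conj_class_def)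
      have "h \<otimes> z \<otimes> inv h = z" using conj_eq_iff[OF h(1) zc zc] centreD(2)[OF zC h(1)] by blast
      then have "z \<otimes> y = h \<otimes> (z \<otimes> x) \<otimes> inv h" using conj_distrib[OF h(1) zc xc] h(2) by simp
      also have "\<dots> = (h \<otimes> g) \<otimes> x \<otimes> inv (h \<otimes> g)" using conj_mult[OF h(1) gc xc] z(2) by simp
      finally show ?thesis using h(1) gc unfolding conj_class_def by blast
    qed
    have steps: "z [^] k \<otimes> y \<in> conj_class G x" if y: "y \<in> conj_class G x" for y and k :: nat
    proof (induction k)
      case 0
      then show ?case using y conj_class_subset[OF xc] by auto
    next
      case (Suc k)
      have "z [^] Suc k \<otimes> y = z \<otimes> (z [^] k \<otimes> y)"
        using y conj_class_subset[OF xc] zc by (subst nat_pow_Suc2) (auto simp: m_assoc)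
      then show ?case using step[OF Suc] by simp
    qed
    \<comment> \<open>The powers of \<open>z\<close> act freely on the class, so the order of
      \<open>z\<close> divides the class size. It is a power of \<open>p\<close> while the class
      size is prime to \<open>p\<close>, hence \<open>z = \<one>\<close>.\<close>
    have "card (generate G {z}) * card ((\<lambda>y. generate G {z} #> y) ` conj_class G x) = card (conj_class G x)"
      by (rule card_left_closed[OF generate_single(1)[OF zc] conj_class_subset[OF xc]])
        (use steps generate_single(3)[OF zc] in auto)
    then have dvd: "ord z dvd card (conj_class G x)"
      unfolding generate_single(2)[OF zc] by (metis dvd_triv_left)
    obtain k where k: "ord z = p ^ k" using z(1) by (auto simp: Zp_def p_element_def)
    have "k = 0"
    proof (rule ccontr)
      assume "k \<noteq> 0"
      then have "p dvd ord z" using k by (cases k) auto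
      then show False using dvd Bd[OF xB] dvd_trans by metis
    qed
    then have "z = \<one>" using k ord_eq_1[OF zc] by simp
    then show "g \<in> centralizer G x" using z(2) centralizer_iff[OF gc xc] xc by simp
  qed
  have DI: "x \<in> D" if x: "pi_element G \<pi> x" and c: "P \<subseteq> centralizer G x" for x
  proof -
    have xc: "x \<in> carrier G" by (rule pi_element_carrier[OF x])
    have "x \<in> B" by (rule BI[OF x not_dvd_class_size[OF pp xc P c]])
    moreover have "g \<otimes> x \<otimes> inv g \<in> Zp #> x" if "g \<in> P" for g
    proof -
      have "g \<otimes> x \<otimes> inv g = x" using centralizer_iff[OF Pc[OF that] xc] c that by blast
      then show ?thesis using rcos_self[OF xc Zp] by simp
    qed
    ultimately show ?thesis by (simp add: D_def)
  qed
  define ZP where "ZP = {x \<in> P. P \<subseteq> centralizer G x}"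
  have ZP: "subgroup ZP G"
  proof (rule subgroupI)
    show "ZP \<subseteq> carrier G" using Pc by (auto simp: ZP_def)
    have "\<one> \<in> ZP" using subgroup.one_closed[OF P(1)] Pc by (auto simp: ZP_def centralizer_def)
    then show "ZP \<noteq> {}" by blast
    show "inv x \<in> ZP" if x: "x \<in> ZP" for x
    proof -
      have "g \<in> centralizer G (inv x)" if g: "g \<in> P" for g
      proof -
        have "x \<in> centralizer G g" using x g Pc by (auto simp: ZP_def centralizer_def)
        then have "inv x \<in> centralizer G g"
          using subgroup.m_inv_closed[OF centralizer_subgroup[OF Pc[OF g]]] by blast
        then show ?thesis using Pc[OF g] by (simp add: centralizer_def)
      qed
      then show ?thesis using x subgroup.m_inv_closed[OF P(1)] by (auto simp: ZP_def)
    qed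
    show "x \<otimes> y \<in> ZP" if x: "x \<in> ZP" and y: "y \<in> ZP" for x y
    proof -
      have "g \<in> centralizer G (x \<otimes> y)" if g: "g \<in> P" for g
      proof -
        have "x \<in> centralizer G g" "y \<in> centralizer G g"
          using x y g Pc by (auto simp: ZP_def centralizer_def)
        then have "x \<otimes> y \<in> centralizer G g"
          using subgroup.m_closed[OF centralizer_subgroup[OF Pc[OF g]]] by blast
        then show ?thesis using Pc[OF g] by (simp add: centralizer_def)
      qed
      then show ?thesis using x y subgroup.m_closed[OF P(1)] by (auto simp: ZP_def)
    qed
  qed
  have ZP_pi: "pi_element G \<pi> x" if "x \<in> ZP" for x
    using pi_element_p_element[OF pp p sylow_p_element[OF pp P]] that by (simp add: ZP_def)
  \<comment> \<open>The free action of \<open>ZP\<close>, the centre of \<open>P\<close>, on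
    \<open>D\<close>: the order of \<open>ZP\<close> divides
    \<open>card D = card Zp * d\<close>.\<close>
  have "card ZP * card ((\<lambda>x. ZP #> x) ` D) = card D"
  proof (rule card_left_closed[OF ZP])
    show "D \<subseteq> carrier G" using Bc by (auto simp: D_def)
    fix a x assume a: "a \<in> ZP" and x: "x \<in> D"
    have xB: "x \<in> B" using x by (simp add: D_def)
    have ac: "a \<in> P" "a \<in> carrier G" using a Pc by (auto simp: ZP_def)
    have ax: "a \<otimes> x = x \<otimes> a" using D_cent[OF x] ac(1) by (auto simp: centralizer_def)
    show "a \<otimes> x \<in> D"
    proof (rule DI)
      show "pi_element G \<pi> (a \<otimes> x)" by (rule pi_element_mult[OF ZP_pi[OF a] Bpi[OF xB] ax])
      show "P \<subseteq> centralizer G (a \<otimes> x)"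
      proof
        fix g assume g: "g \<in> P"
        have "g \<in> centralizer G a" "g \<in> centralizer G x" using a g D_cent[OF x] by (auto simp: ZP_def)
        then have "a \<in> centralizer G g" "x \<in> centralizer G g"
          using ac(2) Bc[OF xB] by (simp_all add: centralizer_def)
        then have "a \<otimes> x \<in> centralizer G g"
          using subgroup.m_closed[OF centralizer_subgroup[OF Pc[OF g]]] by blast
        then show "g \<in> centralizer G (a \<otimes> x)" using Pc[OF g] by (simp add: centralizer_def)
      qed
    qed
  qed
  then have ZP_dvd: "card ZP dvd card Zp * d" using bd(2) by (metis dvd_triv_left)
  obtain s t where st: "\<not> p dvd s" "\<not> p dvd t"
    "card B * t = card (class_size_elements G \<pi> (\<lambda>n. n = 1)) * s"
    using count_p'[OF p] unfolding B_def by blast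
  \<comment> \<open>Cancelling \<open>card Zp\<close> leaves \<open>b * t = card Z' * s\<close>,
    which is prime to \<open>p\<close> because \<open>Z'\<close> is a group of
    \<open>p'\<close>-elements. So \<open>b\<close>, and with it \<open>d\<close>, is prime to
    \<open>p\<close>.\<close>
  have "card Zp * (b * t) = card Zp * (card Z' * s)"
    using st(3) bd(1) card_pi_centre[OF pp, of \<pi>] unfolding Zp_def Z'_def by (simp add: mult.assoc)
  then have "b * t = card Z' * s"
    using subgroup_card_pos[OF Zp] by simp
  moreover have "\<not> p dvd card Z' * s"
    using st(1) pi_p'_centre_not_dvd[OF pp, of \<pi>] prime_dvd_mult_iff[OF pp] unfolding Z'_def by blast
  ultimately have "\<not> p dvd b" by (metis dvd_mult2)
  then have "\<not> p dvd d" using bd(3) by (simp add: dvd_eq_mod_eq_0)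
  moreover obtain j where j: "card ZP = p ^ j"
  proof -
    have "card ZP dvd p ^ multiplicity p (order G)"
      using subgroup_subset_card_dvd[OF ZP P(1)] P(2) by (auto simp: ZP_def sylow_card_def)
    then show thesis using that divides_primepow_nat[OF pp] by blast
  qed
  ultimately have "coprime (card ZP) d" using prime_imp_coprime[OF pp] by simp
  then have "card ZP dvd card Zp" using ZP_dvd coprime_dvd_mult_left_iff by blast
  then have "card ZP \<le> card Zp" using subgroup_card_pos[OF Zp] by (rule dvd_imp_le)
  moreover have "Zp \<subseteq> ZP"
  proof
    fix x assume x: "x \<in> Zp"
    have "P \<subseteq> centralizer G x"
      using Pc centreD[OF Zc[OF x]] by (auto simp: centralizer_def)
    moreover have "p_element G p x" using x by (simp add: Zp_def)
    ultimately show "x \<in> ZP" using p_element_in_sylow[OF pp P] by (simp add: ZP_def)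
  qed
  ultimately have "Zp = ZP"
    using card_seteq[of ZP Zp] finite_subset_carrier[OF subgroup.subset[OF ZP]] by simp
  moreover have "z \<in> ZP" using z by (simp add: ZP_def)
  ultimately show ?thesis using Zc by blast
qed

text \<open>A Sylow subgroup \<open>Q\<close> centralises \<open>x\<close> and therefore its
  \<open>p\<close>-part, which then lies in \<open>Q\<close> and is central there.\<close>

lemma p_part_central:
  assumes p: "p \<in> \<pi>" and x: "x \<in> carrier G" and nd: "\<not> p dvd card (conj_class G x)"
  shows "p_part p x \<in> centre G"
proof -
  have pp: "Factorial_Ring.prime p" by (rule primes[OF p])
  obtain Q where Q: "subgroup Q G" "Q \<subseteq> centralizer G x" "card Q = sylow_card p"
    using sylow_in_if_not_dvd_cofactor[OF pp card_conj_class[OF x] centralizer_subgroup[OF x] nd] by blast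
  have sub: "Q \<subseteq> centralizer G (p_part p x)"
    using Q(2) centralizer_parts(1)[OF pp x] by (rule subset_trans)
  have "p_part p x \<in> Q" by (rule p_element_in_sylow[OF pp Q(1,3) p_element_p_part[OF pp x] sub])
  then show ?thesis using sylow_centre_central[OF p Q(1,3) _ sub] by blast
qed

lemma parts_class_size_dvd:
  assumes p: "Factorial_Ring.prime p" and x: "x \<in> carrier G"
  shows "card (conj_class G (p_part p x)) dvd card (conj_class G x)"
    and "card (conj_class G (p'_part p x)) dvd card (conj_class G x)"
  using x by (auto intro!: conj_class_card_dvd centralizer_parts[OF p] parts_closed[OF p])

text \<open>Cancelling \<open>card Z * card Y\<close> in the chain of estimates leaves
  \<open>card P \<le> card U\<close>, and \<open>U \<subseteq> P\<close> gives equality. So elements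
  of \<open>P\<close> have \<open>p\<close>-power class size, and their classes are
  \<open>P\<close>-orbits.\<close>

lemma sylow_normal_hypercentral:
  assumes p: "p \<in> \<pi>" and P: "subgroup P G" "card P = sylow_card p"
  shows "P \<lhd> G" "P \<subseteq> hypercentre G"
proof -
  have pp: "Factorial_Ring.prime p" by (rule primes[OF p])
  define A where "A = class_size_elements G \<pi> (\<lambda>n. \<exists>k. n = p ^ k)"
  define B where "B = class_size_elements G \<pi> (\<lambda>n. \<not> p dvd n)"
  define Z where "Z = class_size_elements G \<pi> (\<lambda>n. n = 1)"
  define S where "S = class_size_elements G \<pi> (\<lambda>n. True)"
  define Zp where "Zp = {x. pi_element G \<pi> x \<and> p_element G p x} \<inter> centre G"
  define Z' where "Z' = {x. pi_element G \<pi> x \<and> p'_element G p x} \<inter> centre G"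
  define U where "U = {x. p_element G p x \<and> (\<exists>k. card (conj_class G x) = p ^ k)}"
  define Y where "Y = {x. pi_element G \<pi> x \<and> p'_element G p x \<and> \<not> p dvd card (conj_class G x)}"
  have sub: "Zp \<subseteq> carrier G" "Z' \<subseteq> carrier G" "U \<subseteq> carrier G" "Y \<subseteq> carrier G"
    by (auto simp: Zp_def Z'_def U_def Y_def p_element_def p'_element_def)
  note fin = sub[THEN finite_subset_carrier]
  have parts_inj: "inj_on (\<lambda>x. (p_part p x, p'_part p x)) (carrier G)"
  proof (rule inj_onI)
    fix x y assume "x \<in> carrier G" "y \<in> carrier G" "(p_part p x, p'_part p x) = (p_part p y, p'_part p y)"
    then show "x = y" by (metis Pair_inject parts_mult[OF pp])
  qed
  have bound: "card T \<le> card V * card W"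
    if "T \<subseteq> carrier G" "finite V" "finite W" "\<And>x. x \<in> T \<Longrightarrow> p_part p x \<in> V \<and> p'_part p x \<in> W" for T V W
  proof -
    have "card T \<le> card (V \<times> W)"
    proof (rule card_inj_on_le)
      show "inj_on (\<lambda>x. (p_part p x, p'_part p x)) T" by (rule inj_on_subset[OF parts_inj that(1)])
    qed (use that in auto)
    then show ?thesis by (simp add: card_cartesian_product)
  qed
  have A_le: "card A \<le> card U * card Z'"
  proof (rule bound)
    show "A \<subseteq> carrier G" unfolding A_def by (rule class_size_elements_subset)
    fix x assume "x \<in> A"
    then obtain k where x: "pi_element G \<pi> x" "card (conj_class G x) = p ^ k"
      by (auto simp: A_def class_size_elements_def)
    have xc: "x \<in> carrier G" by (rule pi_element_carrier[OF x(1)])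
    have "\<exists>j. card (conj_class G (p_part p x)) = p ^ j" "\<exists>j. card (conj_class G (p'_part p x)) = p ^ j"
      using parts_class_size_dvd[OF pp xc] divides_primepow_nat[OF pp] unfolding x(2) by blast+
    then obtain j where j: "card (conj_class G (p'_part p x)) = p ^ j" and U: "p_part p x \<in> U"
      using p_element_p_part[OF pp xc] unfolding U_def by blast
    let ?v = "p'_part p x"
    have vc: "?v \<in> carrier G" by (rule parts_closed(2)[OF pp xc])
    have v_pi: "pi_element G \<pi> ?v" by (rule pi_element_parts(2)[OF x(1)])
    have v_p': "p'_element G p ?v" by (rule p'_element_p'_part[OF pp xc])
    \<comment> \<open>The centrality of parts is applied at the primes other than \<open>p\<close>:
      the class size of \<open>?v\<close> is a power of \<open>p\<close>, so it is prime to every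
      other \<open>q \<in> \<pi>\<close>. The remaining parts of \<open>?v\<close> are
      trivial.\<close>
    have "?v \<in> centre G"
    proof (rule mem_subgroup_if_parts_mem[OF centre_subgroup vc])
      fix q :: nat assume q: "Factorial_Ring.prime q"
      consider "q = p" | "q \<noteq> p" "q \<in> \<pi>" | "q \<notin> \<pi>" by blast
      then show "p_part q ?v \<in> centre G"
      proof cases
        case 1
        then show ?thesis using parts_p'_element(1)[OF pp v_p'] subgroup.one_closed[OF centre_subgroup] by simp
      next
        case 2
        have "\<not> q dvd p ^ j"
        proof
          assume "q dvd p ^ j"
          then have "q dvd p" by (rule prime_dvd_power[OF q])
          then show False using primes_dvd_imp_eq[OF q pp] 2(1) by blast
        qed
        then show ?thesis using p_part_central[OF 2(2) vc] j by simp
      next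
        case 3
        then show ?thesis using p_part_trivial[OF q _ v_pi] subgroup.one_closed[OF centre_subgroup] by simp
      qed
    qed
    then show "p_part p x \<in> U \<and> p'_part p x \<in> Z'" using U v_pi v_p' by (simp add: Z'_def)
  qed (use fin in auto)
  have B_le: "card B \<le> card Zp * card Y"
  proof (rule bound)
    show "B \<subseteq> carrier G" unfolding B_def by (rule class_size_elements_subset)
    fix x assume "x \<in> B"
    then have x: "pi_element G \<pi> x" "\<not> p dvd card (conj_class G x)"
      by (auto simp: B_def class_size_elements_def)
    have xc: "x \<in> carrier G" by (rule pi_element_carrier[OF x(1)])
    have "p_part p x \<in> Zp"
      using p_part_central[OF p xc x(2)] pi_element_parts(1)[OF x(1)] p_element_p_part[OF pp xc]
      by (simp add: Zp_def)
    moreover have "\<not> p dvd card (conj_class G (p'_part p x))"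
      using parts_class_size_dvd(2)[OF pp xc] x(2) dvd_trans by metis
    then have "p'_part p x \<in> Y"
      using pi_element_parts(2)[OF x(1)] p'_element_p'_part[OF pp xc] by (simp add: Y_def)
    ultimately show "p_part p x \<in> Zp \<and> p'_part p x \<in> Y" by blast
  qed (use fin in auto)
  \<comment> \<open>Choose a Sylow \<open>p\<close>-subgroup \<open>Q y\<close> in the centralizer
    of each \<open>y \<in> Y\<close>. The pairs \<open>(y, u)\<close> with
    \<open>u \<in> Q y\<close> are recovered from the product \<open>u \<otimes> y\<close> as its
    parts.\<close>
  have S_ge: "card Y * card P \<le> card S"
  proof -
    have "\<forall>y \<in> Y. \<exists>Q. subgroup Q G \<and> Q \<subseteq> centralizer G y \<and> card Q = sylow_card p"
    proof
      fix y assume y: "y \<in> Y"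
      then have yc: "y \<in> carrier G" using sub(4) by blast
      show "\<exists>Q. subgroup Q G \<and> Q \<subseteq> centralizer G y \<and> card Q = sylow_card p"
        using sylow_in_if_not_dvd_cofactor[OF pp card_conj_class[OF yc] centralizer_subgroup[OF yc]] y
        by (simp add: Y_def)
    qed
    then obtain Q where Q: "\<And>y. y \<in> Y \<Longrightarrow> subgroup (Q y) G" "\<And>y. y \<in> Y \<Longrightarrow> Q y \<subseteq> centralizer G y"
      "\<And>y. y \<in> Y \<Longrightarrow> card (Q y) = sylow_card p"
      by metis
    have Qp: "p_element G p u" if "y \<in> Y" "u \<in> Q y" for y u
      by (rule sylow_p_element[OF pp Q(1)[OF that(1)] Q(3)[OF that(1)] that(2)])
    have comm: "u \<otimes> y = y \<otimes> u" if "y \<in> Y" "u \<in> Q y" for y u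
      using Q(2)[OF that(1)] that(2) by (auto simp: centralizer_def)
    have parts: "p_part p (u \<otimes> y) = u" "p'_part p (u \<otimes> y) = y" if "y \<in> Y" "u \<in> Q y" for y u
      using parts_of_mult[OF pp Qp[OF that] _ comm[OF that]] that(1) by (auto simp: Y_def)
    have "card (Sigma Y Q) \<le> card S"
    proof (rule card_inj_on_le[of "\<lambda>(y, u). u \<otimes> y"])
      show "inj_on (\<lambda>(y, u). u \<otimes> y) (Sigma Y Q)"
      proof (rule inj_onI, clarify)
        fix y u y' u' assume "y \<in> Y" "u \<in> Q y" "y' \<in> Y" "u' \<in> Q y'" "u \<otimes> y = u' \<otimes> y'"
        then show "y = y' \<and> u = u'" using parts[of y u] parts[of y' u'] by simp
      qed
      show "(\<lambda>(y, u). u \<otimes> y) ` Sigma Y Q \<subseteq> S"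
      proof clarify
        fix y u assume yu: "y \<in> Y" "u \<in> Q y"
        have "pi_element G \<pi> y" using yu(1) by (simp add: Y_def)
        then show "u \<otimes> y \<in> S"
          using pi_element_mult[OF pi_element_p_element[OF pp p Qp[OF yu]] _ comm[OF yu]]
          by (simp add: S_def class_size_elements_def)
      qed
      show "finite S" unfolding S_def by (rule finite_class_size_elements)
    qed
    moreover have "card (Sigma Y Q) = (\<Sum>y \<in> Y. card (Q y))"
      using Q(1) fin(4) finite_subset_carrier[OF subgroup.subset] by (intro card_SigmaI) auto
    moreover have "(\<Sum>y \<in> Y. card (Q y)) = card Y * card P" using Q(3) P(2) by simp
    ultimately show ?thesis by simp
  qed
  have Z: "card Z = card Zp * card Z'"
    unfolding Z_def Zp_def Z'_def by (rule card_pi_centre[OF pp])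
  \<comment> \<open>The identity makes both factors positive, so they can be cancelled.\<close>
  have "\<one> \<in> Z" "\<one> \<in> Y"
    using pi_element_one subgroup.one_closed[OF centre_subgroup] conj_class_card_eq_1_iff[of \<one>] not_prime_1 pp
    by (auto simp: Z_def Y_def class_size_elements_def p'_element_def prime_nat_iff)
  then have pos: "card Z > 0" "card Y > 0"
    using fin(4) finite_class_size_elements[of \<pi> "\<lambda>n. n = 1"] by (auto simp: card_gt_0_iff Z_def)
  have "card Z * (card Y * card P) \<le> card Z * card S" using S_ge by simp
  also have "\<dots> = card A * card B"
    using count_product[OF p] by (simp add: A_def B_def Z_def S_def)
  also have "\<dots> \<le> (card U * card Z') * (card Zp * card Y)" using A_le B_le by (rule mult_le_mono)
  also have "\<dots> = (card Z * card Y) * card U" unfolding Z by simp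
  finally have "(card Z * card Y) * card P \<le> (card Z * card Y) * card U" by (simp add: mult.assoc)
  then have "card P \<le> card U" using pos by simp
  moreover have "U \<subseteq> P"
    using p_element_in_sylow_if_p_power_class[OF pp _ _ P] unfolding U_def by blast
  ultimately have "U = P"
    using card_seteq[of P U] finite_subset_carrier[OF subgroup.subset[OF P(1)]] by simp
  then have cls: "conj_class G x = {g \<otimes> x \<otimes> inv g |g. g \<in> P}" if "x \<in> P" for x
    using class_eq_sylow_orbit[OF pp _ _ P] that sub(3) unfolding U_def by blast
  show "P \<lhd> G" "P \<subseteq> hypercentre G"
    using hypercentral_if_classes_eq_orbits[OF pp P(1) P(2)[unfolded sylow_card_def] cls] by blast+
qed

text \<open>Sylow subgroups for different primes in \<open>\<pi>\<close> are normal of coprime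
  orders, so their orders multiply; the hypercentre is a subgroup and absorbs the products.\<close>

lemma ex_normal_hypercentral_product:
  assumes "finite F" "F \<subseteq> \<pi>"
  shows "\<exists>Q. Q \<lhd> G \<and> Q \<subseteq> hypercentre G \<and> card Q = (\<Prod>p \<in> F. sylow_card p)"
  using assms
proof (induction F)
  case empty
  have "{\<one>} \<subseteq> hypercentre G"
    using subgroup.one_closed[OF normal_imp_subgroup[OF hypercentre_normal]] by simp
  then show ?case using one_is_normal by (intro exI[of _ "{\<one>}"]) simp
next
  case (insert p F)
  then obtain Q where Q: "Q \<lhd> G" "Q \<subseteq> hypercentre G" "card Q = (\<Prod>q \<in> F. sylow_card q)" by auto
  have p: "p \<in> \<pi>" "Factorial_Ring.prime p" using insert.prems primes by auto
  obtain P where P: "subgroup P G" "card P = sylow_card p" using ex_sylow[OF p(2)] by blast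
  note PN = sylow_normal_hypercentral[OF p(1) P]
  have "coprime (sylow_card p) (sylow_card q)" if "q \<in> F" for q
    using primes_coprime[of p q] p(2) primes[of q] insert.prems insert.hyps(2) that
    by (auto simp: sylow_card_def)
  then have "coprime (card P) (card Q)" unfolding P(2) Q(3) by (intro prod_coprime_right)
  then have "card (P <#> Q) = card P * card Q" by (rule card_normal_product[OF PN(1) Q(1)])
  then have "card (P <#> Q) = (\<Prod>q \<in> insert p F. sylow_card q)"
    using insert.hyps P(2) Q(3) by simp
  moreover have "P <#> Q \<subseteq> hypercentre G"
    using PN(2) Q(2) subgroup.m_closed[OF normal_imp_subgroup[OF hypercentre_normal]]
    by (auto simp: set_mult_def)
  moreover have "P <#> Q \<lhd> G" by (rule normal_subgroup_set_mult_closed[OF PN(1) Q(1)])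
  ultimately show ?case by blast
qed

lemma ex_hypercentral_hall: "\<exists>Q. hall_pi_subgroup Q G \<pi> \<and> Q \<subseteq> hypercentre G"
proof -
  \<comment> \<open>Only the primes dividing the group order contribute, which keeps the product
    finite when \<open>\<pi>\<close> is infinite.\<close>
  define F where "F = {p \<in> \<pi>. p dvd order G}"
  have "F \<subseteq> {..order G}" using dvd_imp_le order_pos by (auto simp: F_def)
  then have F: "finite F" "F \<subseteq> \<pi>" using finite_subset by (auto simp: F_def)
  obtain Q where Q: "Q \<lhd> G" "Q \<subseteq> hypercentre G" "card Q = (\<Prod>p \<in> F. sylow_card p)"
    using ex_normal_hypercentral_product[OF F] by blast
  have sub: "subgroup Q G" by (rule normal_imp_subgroup[OF Q(1)])
  have "q \<in> \<pi>" if q: "Factorial_Ring.prime q" "q dvd card Q" for q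
  proof -
    obtain p where p: "p \<in> F" "q dvd sylow_card p"
      using q prime_dvd_prod_iff[OF F(1) q(1), of sylow_card] unfolding Q(3) by blast
    have "q dvd p" using p(2) prime_dvd_power[OF q(1)] by (simp add: sylow_card_def)
    then have "q = p" using primes_dvd_imp_eq[OF q(1)] primes p(1) F(2) by blast
    then show ?thesis using p(1) F(2) by blast
  qed
  moreover have "q \<notin> \<pi>" if q: "Factorial_Ring.prime q" "q dvd card (rcosets Q)" for q
  proof
    assume "q \<in> \<pi>"
    moreover have "q dvd order G" using lagrange[OF sub] q(2) by (metis dvd_mult2)
    ultimately have "q \<in> F" by (simp add: F_def)
    then have "sylow_card q dvd card Q" unfolding Q(3) by (rule dvd_prodI[OF F(1)])
    \<comment> \<open>A prime \<open>q \<in> \<pi>\<close> dividing the index would add a factor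
      \<open>q\<close> to the full \<open>q\<close>-part already present in
      \<open>card Q\<close>.\<close>
    then have "sylow_card q * q dvd card Q * card (rcosets Q)" using q(2) by (rule mult_dvd_mono)
    then have "sylow_card q * q dvd card (carrier G)"
      using lagrange[OF sub] by (simp add: order_def mult.commute)
    then show False by (rule sylow_multiplicity[OF q(1) subgroup_self])
  qed
  ultimately show ?thesis using Q(2) sub unfolding hall_pi_subgroup_def by blast
qed

end

theorem theoremA:
  fixes G :: "('a, 'c) monoid_scheme" and H :: "('b, 'd) monoid_scheme" and \<pi> :: "nat set"
  assumes "group G" and "finite (carrier G)"
    and "group H" and "finite (carrier H)"
    and "\<forall>p \<in> \<pi>. Factorial_Ring.prime p"
    and "\<exists>P. hall_pi_subgroup P G \<pi> \<and> P \<subseteq> hypercentre G"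
    and "\<forall>n::nat. n > 0 \<longrightarrow> num_pi_classes_of_size G \<pi> n = num_pi_classes_of_size H \<pi> n"
  shows "\<exists>Q. hall_pi_subgroup Q H \<pi> \<and> Q \<subseteq> hypercentre H"
proof -
  interpret G: finite_group G
    using assms(1,2) by (simp add: finite_group_def finite_group_axioms_def)
  interpret H: finite_group H
    using assms(3,4) by (simp add: finite_group_def finite_group_axioms_def)
  obtain P where P: "hall_pi_subgroup P G \<pi>" "P \<subseteq> hypercentre G" using assms(6) by blast
  have same: "card (class_size_elements G \<pi> \<phi>) = card (class_size_elements H \<pi> \<phi>)" for \<phi>
  proof -
    \<comment> \<open>A common bound, so that both cardinalities become sums over the same positive
      class sizes.\<close>
    let ?M = "max (order G) (order H)"
    have "(\<Sum>n \<in> {n \<in> {1..?M}. \<phi> n}. n * num_pi_classes_of_size G \<pi> n)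
        = (\<Sum>n \<in> {n \<in> {1..?M}. \<phi> n}. n * num_pi_classes_of_size H \<pi> n)"
      using assms(7) by (intro sum.cong) auto
    then show ?thesis
      using G.card_class_size_elements[of ?M \<pi> \<phi>] H.card_class_size_elements[of ?M \<pi> \<phi>] by simp
  qed
  \<comment> \<open>The counting identities of \<open>G\<close> involve only cardinalities covered
    by \<open>same\<close>, so they hold verbatim in \<open>H\<close>.\<close>
  interpret counted_group H \<pi>
  proof
    fix p assume p: "p \<in> \<pi>"
    show pp: "Factorial_Ring.prime p" using assms(5) p by blast
    show "card (class_size_elements H \<pi> (\<lambda>n. \<exists>k. n = p ^ k)) * card (class_size_elements H \<pi> (\<lambda>n. \<not> p dvd n))
        = card (class_size_elements H \<pi> (\<lambda>n. n = 1)) * card (class_size_elements H \<pi> (\<lambda>n. True))"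
      using G.hall_counts(1)[OF P pp p] unfolding same .
    show "\<exists>s t. \<not> p dvd s \<and> \<not> p dvd t \<and>
        card (class_size_elements H \<pi> (\<lambda>n. \<not> p dvd n)) * t = card (class_size_elements H \<pi> (\<lambda>n. n = 1)) * s"
      using G.hall_counts(2)[OF P pp p] unfolding same .
  qed
  show ?thesis by (rule ex_hypercentral_hall)
qed

end
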